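(* Let $F(z)=\sum_{k=0}^{n}A_kz^{n-k}\in\mathbb C[z]^{p\times p}$ be monic ($A_0=I_p$) of degree $n$. Let $(\mathbf s_k)_{k\ge0}$ be the sequence of right Markov parameters of $F$ if $n=2m$, or of right Markov parameters of second type of $F$ if $n=2m+1$, and assume that the truncated sequence $\mathscr S=(\mathbf s_k)_{k=0}^{n-1}$ consists of Hermitian matrices. Then $F$ is a Hurwitz matrix polynomial if and only if $\mathscr S$ is Stieltjes positive definite, i.e. both block Hankel matrices $[\mathbf s_{j+k}]_{j,k=0}^{\lfloor (n-1)/2\rfloor}$ and $[\mathbf s_{j+k+1}]_{j,k=0}^{\lfloor (n-2)/2\rfloor}$ are positive definite.
   Context: Even/odd parts: if $n=2m$, $F_e(z)=\sum_{k=0}^mA_{2k}z^{m-k}$, $F_o(z)=\sum_{k=1}^mA_{2k-1}z^{m-k}$; if $n=2m+1$, $F_e(z)=\sum_{k=0}^mA_{2k+1}z^{m-k}$, $F_o(z)=\sum_{k=0}^mA_{2k}z^{m-k}$. For $n=2m$ the right Markov parameters are defined by $F_o(z)F_e(z)^{-1}=\sum_{k\ge0}(-1)^kz^{-(k+1)}\mathbf s_k$ for large $|z|$; for $n=2m+1$ the right Markov parameters of second type are defined by $F_e(z)F_o(z)^{-1}=\sum_{k\ge0}(-1)^kz^{-k}\mathbf s_k$ for large $|z|$. A monic matrix polynomial $F$ is a Hurwitz matrix polynomial (Hurwitz stable) if all roots of $\det F(z)$ lie in the open left half-plane $\operatorname{Re}z<0$. *)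

theory Defs
  imports "HOL-Analysis.Analysis"
begin

definition cmat_scale :: "complex \<Rightarrow> complex^'p^'p \<Rightarrow> complex^'p^'p" where
  "cmat_scale c M = (\<chi> i j. c * M $ i $ j)"

definition mpoly_eval :: "(nat \<Rightarrow> complex^'p^'p) \<Rightarrow> nat \<Rightarrow> complex \<Rightarrow> complex^'p^'p" where
  "mpoly_eval A n z = (\<Sum>k\<in>{0..n}. cmat_scale (z ^ (n - k)) (A k))"

definition monic_mpoly :: "(nat \<Rightarrow> complex^'p^'p) \<Rightarrow> bool" where
  "monic_mpoly A \<longleftrightarrow> A 0 = mat 1"

definition even_part :: "(nat \<Rightarrow> complex^'p^'p) \<Rightarrow> nat \<Rightarrow> complex \<Rightarrow> complex^'p^'p" where
  "even_part A n z =
     (if even n then (\<Sum>k\<in>{0..n div 2}. cmat_scale (z ^ (n div 2 - k)) (A (2*k)))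
      else (\<Sum>k\<in>{0..n div 2}. cmat_scale (z ^ (n div 2 - k)) (A (2*k+1))))"

definition odd_part :: "(nat \<Rightarrow> complex^'p^'p) \<Rightarrow> nat \<Rightarrow> complex \<Rightarrow> complex^'p^'p" where
  "odd_part A n z =
     (if even n then (\<Sum>k\<in>{1..n div 2}. cmat_scale (z ^ (n div 2 - k)) (A (2*k-1)))
      else (\<Sum>k\<in>{0..n div 2}. cmat_scale (z ^ (n div 2 - k)) (A (2*k))))"

definition markov_params :: "(nat \<Rightarrow> complex^'p^'p) \<Rightarrow> nat \<Rightarrow> (nat \<Rightarrow> complex^'p^'p) \<Rightarrow> bool" where
  "markov_params A n s \<longleftrightarrow>
     (if even n then
        (\<exists>R. \<forall>z. R < norm z \<longrightarrow> invertible (even_part A n z) \<and>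
           ((\<lambda>k. cmat_scale ((-1) ^ k / z ^ (k + 1)) (s k)) sums
              (odd_part A n z ** matrix_inv (even_part A n z))))
      else
        (\<exists>R. \<forall>z. R < norm z \<longrightarrow> invertible (odd_part A n z) \<and>
           ((\<lambda>k. cmat_scale ((-1) ^ k / z ^ k) (s k)) sums
              (even_part A n z ** matrix_inv (odd_part A n z)))))"

definition hermitian_mat :: "complex^'p^'p \<Rightarrow> bool" where
  "hermitian_mat M \<longleftrightarrow> (\<forall>i j. M $ i $ j = cnj (M $ j $ i))"

text \<open>The block Hankel matrix [s_{j+k+d}]_{j,k=0}^{q-1} (of size qp x qp) is positive
 definite: Hermitian and x^* H x > 0 for every nonzero x in C^{qp}, where x is
 written as q blocks x_0,...,x_{q-1} in C^p.\<close>
definition block_hankel_pd :: "(nat \<Rightarrow> complex^'p^'p) \<Rightarrow> nat \<Rightarrow> nat \<Rightarrow> bool" where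
  "block_hankel_pd s d q \<longleftrightarrow>
     (\<forall>j<q. \<forall>k<q. \<forall>a b. s (j+k+d) $ a $ b = cnj (s (k+j+d) $ b $ a)) \<and>
     (\<forall>x :: nat \<Rightarrow> complex^'p. (\<exists>j<q. x j \<noteq> 0) \<longrightarrow>
        (let Q = (\<Sum>j<q. \<Sum>k<q. \<Sum>a\<in>UNIV. cnj (x j $ a) * ((s (j+k+d) *v x k) $ a))
         in Im Q = 0 \<and> Re Q > 0))"

text \<open>Stieltjes positive definiteness of (s_k)_{k=0}^{n-1}: the block Hankel matrices
 [s_{j+k}]_{j,k=0}^{floor((n-1)/2)} and [s_{j+k+1}]_{j,k=0}^{floor((n-2)/2)} are
 positive definite; their block sizes are (n+1) div 2 and n div 2.\<close>
definition stieltjes_pd :: "(nat \<Rightarrow> complex^'p^'p) \<Rightarrow> nat \<Rightarrow> bool" where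
  "stieltjes_pd s n \<longleftrightarrow> block_hankel_pd s 0 ((n + 1) div 2) \<and> block_hankel_pd s 1 (n div 2)"

definition hurwitz_mpoly :: "(nat \<Rightarrow> complex^'p^'p) \<Rightarrow> nat \<Rightarrow> bool" where
  "hurwitz_mpoly A n \<longleftrightarrow> (\<forall>z. det (mpoly_eval A n z) = 0 \<longrightarrow> Re z < 0)"

end

(* Writing F(z) = E(z^2) + z O(z^2), the equation F(z) u = 0 becomes a quadratic equation
   z^2 a + z b + c = 0, where a and c are values of the two block Hankel forms at vectors
   built from u by Horner's scheme, and b >= 0. Positive definite forms thus force Re z < 0.
   Conversely, let P be the direct sum of the two forms. A suitable G with
   Re <v, G v> <= 0 turns the roots of det F into the eigenvalues (for odd degree, their
   inverses) of the pencil z P - G. The energy <v, P v> does not increase along the Cayley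
   iteration v -> (P - G)^-1 (P + G) v, whose iterates tend to 0 if F is Hurwitz; hence
   the energy is nonnegative, and it is definite because P is injective. *)
theory Submission
  imports Defs "HOL-Library.Function_Algebras"
    "HOL-Computational_Algebra.Fundamental_Theorem_Algebra"
begin

section \<open>Linear operators on finite-dimensional complex spaces\<close>

text \<open>The number of blocks varies with the degree, so block vectors are functions of finite
  support and operators act on a carrier subspace. All spectral information comes from the
  fundamental theorem of algebra, by splitting off one eigenvalue at a time. In the converse,
  positivity of P is the goal, so P cannot serve as an inner product from the start; only its
  injectivity is at hand. It holds because a vector killed at the same w by both parts of F would
  make both square roots of w roots of det F, which cannot both lie in the open left half-plane, and
  because 0 is not a root either. The Cayley iteration stands in for the flow of P x' = G x. It
  carries the left half-plane to the unit disc, so that stability becomes decay of the powers of one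
  operator. In the forward direction b >= 0 alone would still allow imaginary z. The case b = 0 is
  excluded because it would spread through all Hankel rows and make a positive form vanish.\<close>

locale fin_dim_operator = vector_space scale
  for scale :: "complex \<Rightarrow> 'v::ab_group_add \<Rightarrow> 'v" (infixr "*c" 75) +
  fixes V B :: "'v set" and T :: "'v \<Rightarrow> 'v"
  assumes subspace_V: "subspace V"
    and finite_B: "finite B"
    and V_span: "V \<subseteq> span B"
    and T_in: "v \<in> V \<Longrightarrow> T v \<in> V"
    and T_add: "u \<in> V \<Longrightarrow> v \<in> V \<Longrightarrow> T (u + v) = T u + T v"
    and T_scale: "v \<in> V \<Longrightarrow> T (c *c v) = c *c T v"
begin

lemma T_0: "T 0 = 0"
  using T_scale[of 0 0] subspace_0[OF subspace_V] by simp

lemma T_diff: "u \<in> V \<Longrightarrow> v \<in> V \<Longrightarrow> T (u - v) = T u - T v"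
  using T_add[of "u - v" v] subspace_diff[OF subspace_V, of u v] by (simp add: algebra_simps)

lemma T_sum: "finite S \<Longrightarrow> (\<And>i. i \<in> S \<Longrightarrow> f i \<in> V) \<Longrightarrow> T (\<Sum>i\<in>S. f i) = (\<Sum>i\<in>S. T (f i))"
  by (induction S rule: finite_induct) (auto simp: T_0 T_add subspace_sum[OF subspace_V])

lemma funpow_in: "v \<in> V \<Longrightarrow> (T ^^ k) v \<in> V"
  by (induction k) (auto intro: T_in)

section \<open>Polynomials in an operator and induction along eigenvalues\<close>

definition papp :: "complex poly \<Rightarrow> 'v \<Rightarrow> 'v" where
  "papp p v = (\<Sum>i\<le>degree p. coeff p i *c (T ^^ i) v)"

lemma papp_altdef:
  assumes "degree p \<le> n"
  shows "papp p v = (\<Sum>i\<le>n. coeff p i *c (T ^^ i) v)"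
  unfolding papp_def
  by (rule sum.mono_neutral_left) (use assms in \<open>auto intro: coeff_eq_0\<close>)

lemma papp_in: "v \<in> V \<Longrightarrow> papp p v \<in> V"
  unfolding papp_def by (intro subspace_sum[OF subspace_V] subspace_scale[OF subspace_V] funpow_in)

lemma papp_add: "papp (p + q) v = papp p v + papp q v"
proof -
  let ?n = "max (degree p) (degree q)"
  have "degree (p + q) \<le> ?n" by (rule degree_add_le) auto
  then show ?thesis
    by (simp add: papp_altdef[of _ ?n] scale_left_distrib sum.distrib)
qed

lemma papp_smult: "papp (smult c p) v = c *c papp p v"
  by (simp add: papp_altdef[of "smult c p" "degree p"] papp_def scale_sum_right)

lemma papp_pCons: "papp (pCons a p) v = a *c v + papp p (T v)"
proof -
  have "papp (pCons a p) v = (\<Sum>i\<le>Suc (degree p). coeff (pCons a p) i *c (T ^^ i) v)"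
    by (rule papp_altdef) (rule degree_pCons_le)
  also have "\<dots> = a *c v + (\<Sum>i\<le>degree p. coeff p i *c (T ^^ Suc i) v)"
    by (subst sum.atMost_Suc_shift) simp
  finally show ?thesis by (simp add: papp_def funpow_swap1)
qed

lemma papp_T: "v \<in> V \<Longrightarrow> papp p (T v) = T (papp p v)"
  unfolding papp_def
  by (subst T_sum)
    (auto simp: T_scale funpow_in funpow_swap1 intro: subspace_scale[OF subspace_V])

lemma papp_scale: "v \<in> V \<Longrightarrow> papp p (c *c v) = c *c papp p v"
proof -
  assume v: "v \<in> V"
  have "(T ^^ i) (c *c v) = c *c (T ^^ i) v" for i
    by (induction i) (auto simp: T_scale funpow_in v)
  then show ?thesis
    by (simp add: papp_def scale_sum_right mult.commute)
qed

lemma papp_diff: 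
  assumes "u \<in> V" "v \<in> V"
  shows "papp p (u - v) = papp p u - papp p v"
proof -
  have "(T ^^ i) (u - v) = (T ^^ i) u - (T ^^ i) v" for i
    by (induction i) (auto simp: T_diff funpow_in assms)
  then show ?thesis
    by (simp add: papp_def scale_right_diff_distrib sum_subtractf)
qed

text \<open>The factor T - \<mu> may be applied after or before q(T). If the product kills v, the
  first form exhibits q(T) v as an eigenvector, and the second shows that q already kills T v -
  \<mu> v.\<close>

lemma papp_linear_factor:
  assumes "v \<in> V"
  shows "papp ([:-\<mu>, 1:] * q) v = T (papp q v) - \<mu> *c papp q v"
    and "papp ([:-\<mu>, 1:] * q) v = papp q (T v - \<mu> *c v)"
proof -
  have "papp ([:-\<mu>, 1:] * q) v = papp q (T v) - \<mu> *c papp q v"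
    by (simp add: papp_add papp_smult papp_pCons del: smult_minus_left)
  then show "papp ([:-\<mu>, 1:] * q) v = T (papp q v) - \<mu> *c papp q v"
    and "papp ([:-\<mu>, 1:] * q) v = papp q (T v - \<mu> *c v)"
    using assms
    by (simp_all add: papp_T papp_diff T_in papp_scale subspace_scale[OF subspace_V])
qed

text \<open>The iterates of v up to exponent \<open>card B\<close> are too many to be independent in
  \<open>span B\<close>. Dependence is a property of sets, so coinciding iterates are treated
  separately, by a difference of two monomials.\<close>

lemma annihilating_poly:
  assumes v: "v \<in> V"
  obtains p where "p \<noteq> 0" "papp p v = 0"
proof (cases "inj_on (\<lambda>i. (T ^^ i) v) {..card B}")
  case False
  then obtain i j where ij: "i \<noteq> j" "(T ^^ i) v = (T ^^ j) v"
    by (auto simp: inj_on_def)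
  let ?p = "monom 1 i - monom (1::complex) j"
  have mon: "papp (monom 1 k) v = (T ^^ k) v" for k
    by (simp add: papp_def degree_monom_eq) (simp add: if_distrib[of "\<lambda>c. c *c _"] sum.delta cong: if_cong)
  have "papp ?p v = papp (monom 1 i) v + papp (smult (-1) (monom 1 j)) v"
    by (subst papp_add[symmetric]) simp
  also have "\<dots> = 0"
    unfolding papp_smult mon using ij by simp
  finally have "papp ?p v = 0" .
  moreover have "coeff ?p i \<noteq> 0" using ij by simp
  then have "?p \<noteq> 0" by (metis coeff_0)
  ultimately show ?thesis using that by blast
next
  case True
  let ?S = "(\<lambda>i. (T ^^ i) v) ` {..card B}"
  have "card ?S = Suc (card B)" using True by (simp add: card_image)
  moreover have "?S \<subseteq> span B" using V_span funpow_in[OF v] by auto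
  ultimately have "dependent ?S"
    using independent_span_bound[OF finite_B, of ?S] by auto
  then obtain u where u: "\<exists>w\<in>?S. u w \<noteq> 0" "(\<Sum>w\<in>?S. u w *c w) = 0"
    by (auto simp: dependent_finite)
  define p where "p = (\<Sum>i\<le>card B. monom (u ((T ^^ i) v)) i)"
  have cp: "coeff p i = (if i \<le> card B then u ((T ^^ i) v) else 0)" for i
    by (simp add: p_def coeff_sum)
  have "degree p \<le> card B" by (rule degree_le) (simp add: cp)
  then have "papp p v = (\<Sum>i\<le>card B. u ((T ^^ i) v) *c (T ^^ i) v)"
    by (simp add: papp_altdef cp)
  also have "\<dots> = 0" using u(2) by (simp add: sum.reindex[OF True])
  finally have "papp p v = 0" .
  moreover from u(1) obtain i where "i \<le> card B" "coeff p i \<noteq> 0" by (auto simp: cp)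
  then have "p \<noteq> 0" by auto
  ultimately show ?thesis using that by blast
qed

lemma eigenvalue_induct [consumes 1, case_names zero step]:
  assumes v: "v \<in> V"
    and zero: "P 0"
    and step: "\<And>v w \<mu>. v \<in> V \<Longrightarrow> w \<in> V \<Longrightarrow> w \<noteq> 0 \<Longrightarrow> T w = \<mu> *c w \<Longrightarrow> P (T v - \<mu> *c v) \<Longrightarrow> P v"
  shows "P v"
proof -
  have "\<lbrakk>p \<noteq> 0; papp p v = 0; v \<in> V\<rbrakk> \<Longrightarrow> P v" for p v
  proof (induction "degree p" arbitrary: p v)
    case 0
    then obtain a where "p = [:a:]" "a \<noteq> 0" by (metis degree_eq_zeroE pCons_0_0)
    with 0 zero show ?case by (auto simp: papp_def)
  next
    case (Suc n)
    then have "\<not> constant (poly p)" by (simp add: constant_degree)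
    then obtain \<mu> where "poly p \<mu> = 0" using fundamental_theorem_of_algebra by blast
    then obtain q where q: "p = [:-\<mu>, 1:] * q" by (auto simp: poly_eq_0_iff_dvd)
    have q0: "q \<noteq> 0" using q Suc by auto
    then have dq: "degree q = n" using Suc(2) unfolding q by (subst (asm) degree_mult_eq) auto
    show ?case
    proof (cases "papp q v = 0")
      case True
      then show ?thesis using Suc q0 dq by blast
    next
      case False
      have "T (papp q v) = \<mu> *c papp q v"
        using papp_linear_factor(1)[OF Suc(5), of \<mu> q] Suc(4) q by simp
      moreover have "T v - \<mu> *c v \<in> V"
        using Suc(5) by (intro subspace_diff[OF subspace_V] T_in subspace_scale[OF subspace_V])
      moreover have "papp q (T v - \<mu> *c v) = 0"
        using papp_linear_factor(2)[OF Suc(5), of \<mu> q] Suc(4) q by simp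
      ultimately show ?thesis
        using step[OF Suc(5) papp_in[OF Suc(5), of q] False] Suc(1)[OF dq[symmetric] q0] by blast
    qed
  qed
  then show ?thesis using annihilating_poly v by metis
qed

lemma eigenvector_exists:
  assumes "v \<in> V" "v \<noteq> 0"
  obtains w \<mu> where "w \<in> V" "w \<noteq> 0" "T w = \<mu> *c w"
  using assms by (induction v rule: eigenvalue_induct) auto

text \<open>Injectivity makes every eigenvalue \<mu> nonzero, so T v - \<mu> v = T y can be solved
  for v = T ((v - y) / \<mu>). The eigenvalue induction thus replaces a dimension count.\<close>

lemma injective_imp_surjective:
  assumes inj: "\<And>w. w \<in> V \<Longrightarrow> T w = 0 \<Longrightarrow> w = 0" and v: "v \<in> V"
  shows "\<exists>w\<in>V. T w = v"
  using v
proof (induction v rule: eigenvalue_induct)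
  case zero
  show ?case using T_0 subspace_0[OF subspace_V] by blast
next
  case (step v w \<mu>)
  from step inj have "\<mu> \<noteq> 0" by fastforce
  from step(5) obtain y where y: "y \<in> V" "T y = T v - \<mu> *c v" by blast
  have "T ((1/\<mu>) *c (v - y)) = v"
    using \<open>\<mu> \<noteq> 0\<close> step(1) y by (simp add: T_scale T_diff subspace_diff[OF subspace_V])
  then show ?case using step(1) y by (meson subspace_V subspace_diff subspace_scale)
qed

end

section \<open>Decay of the powers of an operator with eigenvalues in the open unit disc\<close>

lemma contraction_recurrence_tendsto_0:
  fixes y e :: "nat \<Rightarrow> complex"
  assumes rec: "\<And>n. y (Suc n) = \<mu> * y n + e n" and \<mu>: "norm \<mu> < 1" and e: "e \<longlonglongrightarrow> 0"
  shows "y \<longlonglongrightarrow> 0"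
proof (rule LIMSEQ_I)
  fix r :: real assume r: "r > 0"
  \<comment> \<open>Chosen so that r / 2 is the fixed point of t -> |\<mu>| t + d; perturbations
    below d then contribute at most r / 2 in total.\<close>
  define d where "d = (1 - norm \<mu>) * (r / 2)"
  have "d > 0" using r \<mu> by (simp add: d_def)
  then obtain N where N: "norm (e n) < d" if "n \<ge> N" for n
    using LIMSEQ_D[OF e] by force
  have bd: "norm (y (N + k)) \<le> norm \<mu> ^ k * norm (y N) + r / 2" for k
  proof (induction k)
    case (Suc k)
    have "norm (y (N + Suc k)) \<le> norm \<mu> * norm (y (N + k)) + norm (e (N + k))"
      using rec[of "N + k"] norm_triangle_ineq[of "\<mu> * y (N + k)"] by (simp add: norm_mult)
    also have "\<dots> \<le> norm \<mu> * (norm \<mu> ^ k * norm (y N) + r / 2) + d"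
      by (intro add_mono mult_left_mono Suc) (use N[of "N + k"] in auto)
    finally show ?case by (simp add: d_def field_simps)
  qed (use r in auto)
  have "(\<lambda>k. norm \<mu> ^ k * norm (y N)) \<longlonglongrightarrow> 0"
    using \<mu> by (intro tendsto_mult_left_zero LIMSEQ_realpow_zero) auto
  then obtain M where M: "norm \<mu> ^ k * norm (y N) < r / 2" if "k \<ge> M" for k
    using LIMSEQ_D[of _ 0 "r / 2"] r by fastforce
  show "\<exists>no. \<forall>n\<ge>no. norm (y n - 0) < r"
  proof (intro exI allI impI)
    fix n assume "n \<ge> N + M"
    then have "M \<le> n - N" "N + (n - N) = n" by auto
    then show "norm (y n - 0) < r" using bd[of "n - N"] M[of "n - N"] by simp
  qed
qed

text \<open>Testing with linear functionals avoids a topology on \<open>V\<close>. With y_n = f (T^n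
  v) one has y_(n+1) = \<mu> y_n + e_n, where e_n belongs to T v - \<mu> v and tends to 0 by
  induction.\<close>

lemma (in fin_dim_operator) functional_funpow_tendsto_0:
  fixes f :: "'v \<Rightarrow> complex"
  assumes ev: "\<And>w \<mu>. w \<in> V \<Longrightarrow> w \<noteq> 0 \<Longrightarrow> T w = \<mu> *c w \<Longrightarrow> norm \<mu> < 1"
    and f_diff: "\<And>u v. u \<in> V \<Longrightarrow> v \<in> V \<Longrightarrow> f (u - v) = f u - f v"
    and f_scale: "\<And>c v. v \<in> V \<Longrightarrow> f (c *c v) = c * f v"
    and v: "v \<in> V"
  shows "(\<lambda>n. f ((T ^^ n) v)) \<longlonglongrightarrow> 0"
  using v
proof (induction v rule: eigenvalue_induct)
  case zero
  have "(T ^^ n) 0 = 0" for n by (induction n) (auto simp: T_0)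
  moreover have "f 0 = 0" using f_scale[of 0 0] subspace_0[OF subspace_V] by simp
  ultimately show ?case by simp
next
  case (step v w \<mu>)
  show ?case
  proof (rule contraction_recurrence_tendsto_0[where \<mu> = \<mu>, OF _ _ step(5)])
    fix n
    have eq: "(T ^^ k) (T v - \<mu> *c v) = T ((T ^^ k) v) - \<mu> *c (T ^^ k) v" for k
      by (induction k)
        (simp_all add: T_diff T_scale T_in funpow_in step(1) subspace_scale[OF subspace_V])
    show "f ((T ^^ Suc n) v) = \<mu> * f ((T ^^ n) v) + f ((T ^^ n) (T v - \<mu> *c v))"
      unfolding eq by (simp add: f_diff f_scale T_in funpow_in step(1) subspace_scale[OF subspace_V])
  qed (use ev step in auto)
qed

section \<open>Dissipative pencils on block vectors\<close>

definition cinner :: "complex^'p \<Rightarrow> complex^'p \<Rightarrow> complex" where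
  "cinner x y = (\<Sum>a\<in>UNIV. cnj (x $ a) * y $ a)"

lemma cinner_add_left: "cinner (x + y) z = cinner x z + cinner y z"
  and cinner_add_right: "cinner x (y + z) = cinner x y + cinner x z"
  and cinner_diff_left: "cinner (x - y) z = cinner x z - cinner y z"
  and cinner_diff_right: "cinner x (y - z) = cinner x y - cinner x z"
  and cinner_scale_left: "cinner (c *s x) y = cnj c * cinner x y"
  and cinner_scale_right: "cinner x (c *s y) = c * cinner x y"
  and cinner_zero_left: "cinner 0 y = 0"
  and cinner_zero_right: "cinner x 0 = 0"
  by (simp_all add: cinner_def algebra_simps sum.distrib sum_subtractf sum_distrib_left)

lemma cinner_minus_left: "cinner (- x) y = - cinner x y"
  and cinner_minus_right: "cinner x (- y) = - cinner x y"
  by (simp_all add: cinner_def sum_negf)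

lemma cinner_sum_left: "cinner (\<Sum>i\<in>S. f i) y = (\<Sum>i\<in>S. cinner (f i) y)"
  and cinner_sum_right: "cinner y (\<Sum>i\<in>S. f i) = (\<Sum>i\<in>S. cinner y (f i))"
  by (induction S rule: infinite_finite_induct)
    (simp_all add: cinner_zero_left cinner_zero_right cinner_add_left cinner_add_right)

lemma cnj_cinner: "cnj (cinner x y) = cinner y x"
  by (simp add: cinner_def mult.commute)

lemma cinner_self: "cinner x x = of_real (\<Sum>a\<in>UNIV. (cmod (x $ a))\<^sup>2)"
  unfolding cinner_def of_real_sum
  by (intro sum.cong refl) (metis complex_norm_square mult.commute)

lemma Im_cinner_self: "Im (cinner x x) = 0"
  by (simp add: cinner_self)

lemma Re_cinner_self_nonneg: "Re (cinner x x) \<ge> 0"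
  by (simp add: cinner_self sum_nonneg)

lemma cinner_self_eq_0: "cinner x x = 0 \<longleftrightarrow> x = 0"
proof -
  have "cinner x x = 0 \<longleftrightarrow> (\<forall>a. (cmod (x $ a))\<^sup>2 = 0)"
    unfolding cinner_self of_real_eq_0_iff by (subst sum_nonneg_eq_0_iff) auto
  then show ?thesis by (simp add: vec_eq_iff)
qed

lemma Re_cinner_self_pos: "x \<noteq> 0 \<Longrightarrow> Re (cinner x x) > 0"
  using cinner_self_eq_0[of x] Re_cinner_self_nonneg[of x] Im_cinner_self[of x]
  by (metis complex_eq_iff less_eq_real_def zero_complex.simps)

lemma cinner_hermitian_mat:
  assumes "hermitian_mat M"
  shows "cinner x (M *v y) = cinner (M *v x) y"
proof -
  have M: "cnj (M $ a $ b) = M $ b $ a" for a b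
    using assms by (metis hermitian_mat_def)
  have "cinner x (M *v y) = (\<Sum>a\<in>UNIV. \<Sum>b\<in>UNIV. cnj (x $ a) * (M $ a $ b * y $ b))"
    by (simp add: cinner_def matrix_vector_mult_def sum_distrib_left)
  also have "\<dots> = (\<Sum>b\<in>UNIV. \<Sum>a\<in>UNIV. cnj (x $ a) * (M $ a $ b * y $ b))"
    by (rule sum.swap)
  also have "\<dots> = cinner (M *v x) y"
    by (simp add: cinner_def matrix_vector_mult_def sum_distrib_right M) 
      (simp add: mult_ac)
  finally show ?thesis .
qed

section \<open>Block vectors of finite support and their inner product\<close>

definition block_scale :: "complex \<Rightarrow> ('i \<Rightarrow> complex^'p) \<Rightarrow> 'i \<Rightarrow> complex^'p" where
  "block_scale c v = (\<lambda>i. c *s v i)"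

text \<open>The index type is arbitrary, so that a direct sum of two block spaces is again a block
  space, over a sum type. The support condition lets the blocks in \<open>I\<close> determine the
  vector.\<close>

definition block_space :: "'i set \<Rightarrow> ('i \<Rightarrow> complex^'p) set" where
  "block_space I = {v. \<forall>i. i \<notin> I \<longrightarrow> v i = 0}"

definition block_inner :: "'i set \<Rightarrow> ('i \<Rightarrow> complex^'p) \<Rightarrow> ('i \<Rightarrow> complex^'p) \<Rightarrow> complex" where
  "block_inner I u v = (\<Sum>i\<in>I. cinner (u i) (v i))"

interpretation block: vector_space "block_scale :: complex \<Rightarrow> ('i \<Rightarrow> complex^'p) \<Rightarrow> _"
  by unfold_locales (auto simp: block_scale_def fun_eq_iff vec_eq_iff algebra_simps)

lemma block_space_subspace: "block.subspace (block_space I)"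
  by (rule block.subspaceI) (auto simp: block_space_def block_scale_def)

lemma block_space_add: "u \<in> block_space I \<Longrightarrow> v \<in> block_space I \<Longrightarrow> u + v \<in> block_space I"
  and block_space_diff: "u \<in> block_space I \<Longrightarrow> v \<in> block_space I \<Longrightarrow> u - v \<in> block_space I"
  and block_space_scale: "v \<in> block_space I \<Longrightarrow> block_scale c v \<in> block_space I"
  by (auto simp: block_space_def block_scale_def)

definition block_basis :: "'i set \<Rightarrow> ('i \<Rightarrow> complex^'p) set" where
  "block_basis I = (\<lambda>(i, a). (\<lambda>j. if j = i then axis a 1 else 0)) ` (I \<times> UNIV)"

lemma finite_block_basis: "finite I \<Longrightarrow> finite (block_basis I)"
  by (simp add: block_basis_def)

lemma fun_sum_apply: "(\<Sum>x\<in>S. f x) i = (\<Sum>x\<in>S. f x i)"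
  for f :: "'a \<Rightarrow> 'b \<Rightarrow> 'c::comm_monoid_add"
  by (induction S rule: infinite_finite_induct) auto

lemma block_space_span:
  fixes I :: "'i set"
  assumes "finite I"
  shows "block_space I \<subseteq> block.span (block_basis I)"
proof
  fix v :: "'i \<Rightarrow> complex^'p" assume v: "v \<in> block_space I"
  have "v = (\<Sum>(i, a)\<in>I \<times> UNIV. block_scale (v i $ a) (\<lambda>j. if j = i then axis a 1 else 0))"
    (is "v = ?w")
  proof
    fix j
    have "?w j = (\<Sum>(i, a)\<in>I \<times> UNIV. (if j = i then v j $ a *s axis a 1 else 0))"
      unfolding fun_sum_apply by (intro sum.cong) (auto simp: block_scale_def)
    also have "\<dots> = (\<Sum>i\<in>I. if j = i then \<Sum>a\<in>UNIV. v j $ a *s axis a 1 else 0)"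
      unfolding sum.cartesian_product[symmetric] by (intro sum.cong) auto
    also have "\<dots> = v j"
      using v assms by (auto simp: sum.delta' basis_expansion block_space_def)
    finally show "v j = ?w j" ..
  qed
  also have "\<dots> \<in> block.span (block_basis I)"
    by (rule block.span_sum)
      (clarsimp, rule block.span_scale, rule block.span_base, force simp: block_basis_def)
  finally show "v \<in> block.span (block_basis I)" .
qed

lemma block_operatorI:
  assumes "finite I"
    and "\<And>v. v \<in> block_space I \<Longrightarrow> T v \<in> block_space I"
    and "\<And>u v. u \<in> block_space I \<Longrightarrow> v \<in> block_space I \<Longrightarrow> T (u + v) = T u + T v"
    and "\<And>c v. v \<in> block_space I \<Longrightarrow> T (block_scale c v) = block_scale c (T v)"
  shows "fin_dim_operator block_scale (block_space I) (block_basis I) T"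
  using assms by unfold_locales (auto intro: block_space_subspace finite_block_basis
      subsetD[OF block_space_span])

lemma block_inner_add_left: "block_inner I (u + v) w = block_inner I u w + block_inner I v w"
  and block_inner_diff_left: "block_inner I (u - v) w = block_inner I u w - block_inner I v w"
  and block_inner_diff_right: "block_inner I w (u - v) = block_inner I w u - block_inner I w v"
  and block_inner_scale_left: "block_inner I (block_scale c v) w = cnj c * block_inner I v w"
  and block_inner_scale_right: "block_inner I w (block_scale c v) = c * block_inner I w v"
  by (simp_all add: block_inner_def block_scale_def cinner_add_left
      cinner_diff_left cinner_diff_right cinner_scale_left cinner_scale_right sum.distrib
      sum_subtractf sum_distrib_left)

lemma cnj_block_inner: "cnj (block_inner I u v) = block_inner I v u"
  by (simp add: block_inner_def cnj_cinner)

lemma block_inner_self_pos: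
  assumes "finite I" "v \<in> block_space I" "v \<noteq> 0"
  shows "Re (block_inner I v v) > 0"
proof -
  from assms obtain i where "i \<in> I" "v i \<noteq> 0"
    by (force simp: block_space_def fun_eq_iff)
  then show ?thesis
    using assms by (auto simp: block_inner_def intro!: sum_pos2[of I i] Re_cinner_self_pos
        Re_cinner_self_nonneg)
qed

section \<open>Stable dissipative pencils and their Cayley transform\<close>

lemma diff_diff_swap: "(a - b) - (c - d) = (a - c) - (b - d)" for a :: "'a::ab_group_add"
  by (simp add: algebra_simps)

text \<open>Modelled on the linear system P x' = G x: for self-adjoint P the derivative of <x, P x>
  is 2 Re <x, G x> <= 0, so the form of P is a Lyapunov function, and \<open>stable\<close> says
  that all modes decay. P may be indefinite a priori; its positivity is the conclusion.\<close>

locale block_pencil =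
  fixes I :: "'i set" and P G :: "('i \<Rightarrow> complex^'p) \<Rightarrow> 'i \<Rightarrow> complex^'p"
  assumes finite_I: "finite I"
    and P_in: "v \<in> block_space I \<Longrightarrow> P v \<in> block_space I"
    and G_in: "v \<in> block_space I \<Longrightarrow> G v \<in> block_space I"
    and P_add: "u \<in> block_space I \<Longrightarrow> v \<in> block_space I \<Longrightarrow> P (u + v) = P u + P v"
    and G_add: "u \<in> block_space I \<Longrightarrow> v \<in> block_space I \<Longrightarrow> G (u + v) = G u + G v"
    and P_scale: "v \<in> block_space I \<Longrightarrow> P (block_scale c v) = block_scale c (P v)"
    and G_scale: "v \<in> block_space I \<Longrightarrow> G (block_scale c v) = block_scale c (G v)"
    and P_inj: "v \<in> block_space I \<Longrightarrow> P v = 0 \<Longrightarrow> v = 0"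
    and P_selfadj: "u \<in> block_space I \<Longrightarrow> v \<in> block_space I \<Longrightarrow>
          block_inner I u (P v) = block_inner I (P u) v"
    and G_dissipative: "v \<in> block_space I \<Longrightarrow> Re (block_inner I v (G v)) \<le> 0"
    and stable: "v \<in> block_space I \<Longrightarrow> v \<noteq> 0 \<Longrightarrow> block_scale \<kappa> (P v) = G v \<Longrightarrow> Re \<kappa> < 0"
begin

abbreviation V :: "('i \<Rightarrow> complex^'p) set" where "V \<equiv> block_space I"
abbreviation "energy v \<equiv> Re (block_inner I v (P v))"

lemmas V_add = block_space_add[of _ I]
lemmas V_diff = block_space_diff[of _ I]
lemmas V_scale = block_space_scale[of _ I]

lemma P_diff: "u \<in> V \<Longrightarrow> v \<in> V \<Longrightarrow> P (u - v) = P u - P v"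
  and G_diff: "u \<in> V \<Longrightarrow> v \<in> V \<Longrightarrow> G (u - v) = G u - G v"
  using P_add[of "u - v" v] G_add[of "u - v" v] V_diff[of u v] by (simp_all add: algebra_simps)

text \<open>A kernel vector would be an eigenvector of the pencil for the value 1, which lies
  outside the left half-plane.\<close>

lemma PG_inj:
  assumes v: "v \<in> V" and "P v - G v = 0"
  shows "v = 0"
proof (rule ccontr)
  assume "v \<noteq> 0"
  moreover have "block_scale 1 (P v) = G v" using assms by simp
  ultimately have "Re 1 < 0" using stable v by blast
  then show False by simp
qed

lemma PG_surj:
  assumes "v \<in> V"
  shows "\<exists>w\<in>V. P w - G w = v"
proof -
  interpret Q: fin_dim_operator block_scale V "block_basis I" "\<lambda>w. P w - G w"
    by (rule block_operatorI)
      (auto simp: finite_I P_in G_in V_diff P_add G_add P_scale G_scale block.scale_right_diff_distrib)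
  show ?thesis using Q.injective_imp_surjective PG_inj assms by blast
qed

text \<open>One step of the implicit midpoint rule for P x' = G x with step size 2.
  \<open>SOME\<close> picks the solution that \<open>PG_surj\<close> provides and
  \<open>PG_inj\<close> makes unique; outside \<open>V\<close> the value is unspecified.\<close>

definition cayley where
  "cayley v = (SOME w. w \<in> V \<and> P w - G w = P v + G v)"

lemma cayley_in: "v \<in> V \<Longrightarrow> cayley v \<in> V"
  and cayley_eq: "v \<in> V \<Longrightarrow> P (cayley v) - G (cayley v) = P v + G v"
proof -
  have "cayley v \<in> V \<and> P (cayley v) - G (cayley v) = P v + G v" if "v \<in> V"
    using someI_ex[of "\<lambda>w. w \<in> V \<and> P w - G w = P v + G v"]
      PG_surj[OF V_add[OF P_in G_in, OF that that]]
    unfolding cayley_def by blast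
  then show "v \<in> V \<Longrightarrow> cayley v \<in> V"
    "v \<in> V \<Longrightarrow> P (cayley v) - G (cayley v) = P v + G v" by auto
qed

lemma cayley_unique:
  assumes "v \<in> V" "w \<in> V" "P w - G w = P v + G v"
  shows "cayley v = w"
proof -
  have eq: "P (cayley v) - G (cayley v) = P w - G w" by (simp only: cayley_eq assms)
  have "P (cayley v - w) - G (cayley v - w) = (P (cayley v) - G (cayley v)) - (P w - G w)"
    unfolding P_diff[OF cayley_in assms(2), OF assms(1)] G_diff[OF cayley_in assms(2), OF assms(1)]
    by (rule diff_diff_swap)
  also have "\<dots> = 0" using eq by simp
  finally have "cayley v - w = 0"
    by (rule PG_inj[OF V_diff[OF cayley_in[OF assms(1)] assms(2)]])
  then show ?thesis by simp
qed

sublocale K: fin_dim_operator block_scale V "block_basis I" cayley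
proof (rule block_operatorI)
  fix u v assume uv: "u \<in> V" "v \<in> V"
  show "cayley (u + v) = cayley u + cayley v"
    using cayley_eq[of u] cayley_eq[of v] uv
    by (intro cayley_unique) (simp_all add: V_add cayley_in P_add G_add algebra_simps)
next
  fix c v assume v: "v \<in> V"
  show "cayley (block_scale c v) = block_scale c (cayley v)"
    using arg_cong[OF cayley_eq[of v], of "block_scale c"] v
    by (intro cayley_unique) (simp_all add: V_scale cayley_in P_scale G_scale
        block.scale_right_diff_distrib block.scale_right_distrib)
qed (auto simp: finite_I cayley_in)

text \<open>An eigenvalue \<mu> belongs to the pencil value \<kappa> = (\<mu> - 1) / (\<mu> + 1),
  whose real part has the sign of |\<mu>|^2 - 1. The value \<mu> = -1 would correspond to \<kappa>
  at infinity and is excluded by injectivity of P.\<close>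

lemma cayley_eigenvalue:
  assumes w: "w \<in> V" "w \<noteq> 0" "cayley w = block_scale \<mu> w"
  shows "norm \<mu> < 1"
proof -
  have eq: "block_scale \<mu> (P w) - block_scale \<mu> (G w) = P w + G w"
    using cayley_eq[OF w(1)] w by (simp add: P_scale G_scale)
  have eq2: "block_scale (\<mu> - 1) (P w) = block_scale (\<mu> + 1) (G w)"
    using eq by (simp add: block.scale_left_diff_distrib block.scale_left_distrib algebra_simps)
  have "\<mu> \<noteq> -1"
  proof
    assume "\<mu> = -1"
    then have "block_scale (-2) (P w) = 0" using eq2 by simp
    then have "P w = 0" by simp
    then show False using P_inj[OF w(1)] w(2) by simp
  qed
  then have nz: "\<mu> + 1 \<noteq> 0" by (simp add: add_eq_0_iff2)
  define \<kappa> where "\<kappa> = (\<mu> - 1) / (\<mu> + 1)"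
  have "block_scale \<kappa> (P w) = block_scale (1 / (\<mu> + 1)) (block_scale (\<mu> - 1) (P w))"
    by (simp add: \<kappa>_def)
  also have "\<dots> = G w" unfolding eq2 using nz by simp
  finally have "Re \<kappa> < 0" using stable w by blast
  moreover have "Re \<kappa> = ((norm \<mu>)\<^sup>2 - 1) / (norm (\<mu> + 1))\<^sup>2"
    unfolding \<kappa>_def Re_divide cmod_power2 by (simp add: power2_eq_square algebra_simps)
  ultimately have "(norm \<mu>)\<^sup>2 < 1"
    using nz by (simp add: divide_less_0_iff)
  then show ?thesis by (simp add: power_less_one_iff)
qed

text \<open>For w = \<open>cayley v\<close>, the cross terms cancel in the real part because P is
  self-adjoint, so the energy difference is Re <w + v, P w - P v> = Re <w + v, G (w + v)>.\<close>

lemma energy_cayley_le: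
  assumes v: "v \<in> V"
  shows "energy (cayley v) \<le> energy v"
proof -
  let ?w = "cayley v"
  note wv = cayley_in[OF v] v
  have "P ?w - P v = G (?w + v)"
    using cayley_eq[OF v] wv by (simp add: G_add algebra_simps)
  then have "Re (block_inner I (?w + v) (P ?w - P v)) \<le> 0"
    using G_dissipative[OF V_add[OF wv]] by simp
  moreover have "block_inner I (?w + v) (P ?w - P v) =
      block_inner I ?w (P ?w) - block_inner I v (P v)
      - (block_inner I ?w (P v) - block_inner I v (P ?w))"
    by (simp add: block_inner_add_left block_inner_diff_right)
  moreover have "cnj (block_inner I ?w (P v)) = block_inner I v (P ?w)"
    using P_selfadj[of v ?w] wv by (simp add: cnj_block_inner)
  then have "Re (block_inner I ?w (P v)) = Re (block_inner I v (P ?w))"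
    using cnj.sel(1)[of "block_inner I ?w (P v)"] by simp
  ultimately show ?thesis by simp
qed

lemma energy_nonneg:
  assumes v: "v \<in> V"
  shows "energy v \<ge> 0"
proof -
  let ?K = "\<lambda>n. (cayley ^^ n) v"
  have Kin: "?K n \<in> V" for n by (rule K.funpow_in[OF v])
  have x: "(\<lambda>n. ?K n i $ a) \<longlonglongrightarrow> 0" for i a
    by (rule K.functional_funpow_tendsto_0[where f = "\<lambda>v. v i $ a"])
      (use cayley_eigenvalue v in \<open>auto simp: block_scale_def\<close>)
  \<comment> \<open>Coordinates of P v are themselves linear functionals of v, so the same decay
    result covers them directly.\<close>
  have y: "(\<lambda>n. P (?K n) i $ a) \<longlonglongrightarrow> 0" for i a
    by (rule K.functional_funpow_tendsto_0[where f = "\<lambda>v. P v i $ a"])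
      (use cayley_eigenvalue v in \<open>auto simp: P_diff P_scale, auto simp: block_scale_def\<close>)
  have "(\<lambda>n. cnj (?K n i $ a)) \<longlonglongrightarrow> 0" for i a
    using tendsto_cnj[OF x[of i a]] by simp
  then have "(\<lambda>n. block_inner I (?K n) (P (?K n))) \<longlonglongrightarrow> 0"
    unfolding block_inner_def cinner_def
    by (intro tendsto_null_sum tendsto_mult_zero y)
  then have lim: "(\<lambda>n. energy (?K n)) \<longlonglongrightarrow> 0"
    using tendsto_Re by fastforce
  have "energy (?K n) \<le> energy v" for n
    by (induction n) (auto intro: order_trans[OF energy_cayley_le[OF Kin]])
  then show ?thesis using LIMSEQ_le_const2[OF lim] by blast
qed

text \<open>A vector of energy 0 would minimize the nonnegative energy. Moving from v in the
  direction - P v changes the energy to t^2 b - 2 t a with a = |P v|^2 > 0, which is negative for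
  small t > 0.\<close>

lemma energy_pos:
  assumes v: "v \<in> V" "v \<noteq> 0"
  shows "energy v > 0"
proof (rule ccontr)
  assume "\<not> energy v > 0"
  then have 0: "energy v = 0" using energy_nonneg v by force
  define a where "a = Re (block_inner I (P v) (P v))"
  define b where "b = energy (P v)"
  have a: "a > 0" unfolding a_def
    by (rule block_inner_self_pos) (use finite_I P_in P_inj v in auto)
  have b: "b \<ge> 0" unfolding b_def using energy_nonneg P_in v by blast
  have q: "energy (v - block_scale (of_real t) (P v)) = t\<^sup>2 * b - 2 * t * a" for t
    using v 0 P_selfadj[of v "P v"]
    by (simp add: P_diff P_scale P_in V_scale block_inner_diff_left block_inner_diff_right
        block_inner_scale_left block_inner_scale_right a_def b_def power2_eq_square algebra_simps)
  have "t\<^sup>2 * b - 2 * t * a \<ge> 0" for t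
    unfolding q[symmetric] by (intro energy_nonneg V_diff V_scale P_in v)
  \<comment> \<open>Any t strictly between 0 and 2 a / b would do; the added 1 covers b = 0.\<close>
  from this[of "a / (b + 1)"] have "(a / (b + 1))\<^sup>2 * b \<ge> 2 * (a / (b + 1)) * a" by simp
  then have "a\<^sup>2 * b \<ge> 2 * a\<^sup>2 * (b + 1)"
    using b by (simp add: power2_eq_square divide_simps split: if_splits)
  moreover have "a\<^sup>2 * b \<ge> 0" "a\<^sup>2 > 0" using a b by auto
  ultimately show False by (simp add: algebra_simps)
qed

end

section \<open>Horner vectors and block Hankel matrices\<close>

definition mvpoly :: "(nat \<Rightarrow> complex^'p^'p) \<Rightarrow> nat \<Rightarrow> complex \<Rightarrow> complex^'p \<Rightarrow> complex^'p" where
  "mvpoly B m w u = (\<Sum>i\<le>m. w ^ i *s (B i *v u))"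

text \<open>Tails of the Horner scheme. Coefficients are indexed by ascending powers, the reverse of
  the numbering of F.\<close>

definition horner :: "(nat \<Rightarrow> complex^'p^'p) \<Rightarrow> nat \<Rightarrow> complex \<Rightarrow> complex^'p \<Rightarrow> nat \<Rightarrow> complex^'p" where
  "horner B m w u k = (\<Sum>i\<in>{k..m}. w ^ (i - k) *s (B i *v u))"

text \<open>Without the signs these are the coefficients in t of (B(t) - B(w)) / (t - w) applied to
  u. The alternating signs match those of the Markov series.\<close>

definition horner_vec :: "(nat \<Rightarrow> complex^'p^'p) \<Rightarrow> nat \<Rightarrow> complex \<Rightarrow> complex^'p \<Rightarrow> nat \<Rightarrow> complex^'p" where
  "horner_vec B m w u k = (if k < m then (-1) ^ k *s horner B m w u (Suc k) else 0)"

text \<open>The row index j is unrestricted: row \<open>Suc j\<close> is row j of the shifted Hankel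
  matrix, so one definition serves both forms.\<close>

definition hankel_row :: "(nat \<Rightarrow> complex^'p^'p) \<Rightarrow> nat \<Rightarrow> (nat \<Rightarrow> complex^'p) \<Rightarrow> nat \<Rightarrow> complex^'p" where
  "hankel_row \<sigma> m x j = (\<Sum>k<m. \<sigma> (j + k) *v x k)"

lemma matrix_vector_mult_minus: "(A :: complex^'n^'m) *v (- x) = - (A *v x)"
  using matrix_vector_mult_diff_distrib[of A 0 x] by simp

lemma matrix_vector_mult_sum: "(A :: complex^'n^'m) *v (\<Sum>i\<in>S. f i) = (\<Sum>i\<in>S. A *v f i)"
  by (induction S rule: infinite_finite_induct) (auto simp: matrix_vector_right_distrib)

lemma vector_scale_sum: "(c::complex) *s (\<Sum>i\<in>S. f i) = (\<Sum>i\<in>S. c *s f i)"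
  by (induction S rule: infinite_finite_induct) (auto simp: vector_add_ldistrib)

lemma hankel_row_add: "hankel_row \<sigma> m (\<lambda>k. x k + y k) j = hankel_row \<sigma> m x j + hankel_row \<sigma> m y j"
  and hankel_row_diff: "hankel_row \<sigma> m (\<lambda>k. x k - y k) j = hankel_row \<sigma> m x j - hankel_row \<sigma> m y j"
  and hankel_row_scale: "hankel_row \<sigma> m (\<lambda>k. c *s x k) j = c *s hankel_row \<sigma> m x j"
  and hankel_row_minus: "hankel_row \<sigma> m (\<lambda>k. - x k) j = - hankel_row \<sigma> m x j"
  and hankel_row_zero: "hankel_row \<sigma> m (\<lambda>k. 0) j = 0"
  by (simp_all add: hankel_row_def matrix_vector_right_distrib matrix_vector_mult_diff_distrib
      vector_scalar_commute sum.distrib sum_subtractf vector_scale_sum matrix_vector_mult_minus sum_negf)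

lemma hankel_row_adjoint:
  assumes "\<And>k. k < 2 * m - 1 \<Longrightarrow> hermitian_mat (\<sigma> k)"
  shows "(\<Sum>j<m. cinner (x j) (hankel_row \<sigma> m y j)) = (\<Sum>j<m. cinner (hankel_row \<sigma> m x j) (y j))"
proof -
  have "(\<Sum>j<m. cinner (x j) (hankel_row \<sigma> m y j)) = (\<Sum>j<m. \<Sum>k<m. cinner (x j) (\<sigma> (j + k) *v y k))"
    by (simp add: hankel_row_def cinner_sum_right)
  also have "\<dots> = (\<Sum>j<m. \<Sum>k<m. cinner (\<sigma> (k + j) *v x j) (y k))"
    by (intro sum.cong refl, subst cinner_hermitian_mat) (auto intro: assms simp: add.commute)
  also have "\<dots> = (\<Sum>k<m. \<Sum>j<m. cinner (\<sigma> (k + j) *v x j) (y k))" by (rule sum.swap)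
  also have "\<dots> = (\<Sum>j<m. cinner (hankel_row \<sigma> m x j) (y j))"
    by (simp add: hankel_row_def cinner_sum_left)
  finally show ?thesis .
qed

lemma horner_0: "horner B m w u 0 = mvpoly B m w u"
  by (simp add: horner_def mvpoly_def atLeast0AtMost)

lemma horner_rec:
  assumes "k < m"
  shows "horner B m w u k = B k *v u + w *s horner B m w u (Suc k)"
proof -
  have "horner B m w u k = B k *v u + (\<Sum>i\<in>{Suc k..m}. w ^ (i - k) *s (B i *v u))"
    using assms unfolding horner_def by (subst sum.atLeast_Suc_atMost) auto
  also have "(\<Sum>i\<in>{Suc k..m}. w ^ (i - k) *s (B i *v u)) = w *s horner B m w u (Suc k)"
    unfolding horner_def vector_scale_sum
  proof (intro sum.cong refl)
    fix i assume "i \<in> {Suc k..m}"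
    then have "i - k = Suc (i - Suc k)" by auto
    then show "w ^ (i - k) *s (B i *v u) = w *s (w ^ (i - Suc k) *s (B i *v u))"
      by (simp add: vector_smult_assoc)
  qed
  finally show ?thesis .
qed

text \<open>Up to the sign (-1)^j, the recurrence is the vanishing of the coefficient of w^-(j+1) in
  the product of the series with terms (-1)^k w^-(k+1) \<sigma>_k and B(w): the product is a
  polynomial.\<close>

locale monic_hankel =
  fixes m :: nat and B \<sigma> :: "nat \<Rightarrow> complex^'p^'p"
  assumes monic: "B m = mat 1"
    and recurrence: "\<And>j u. (\<Sum>i\<le>m. (-1) ^ i *s (\<sigma> (j + i) *v (B i *v u))) = 0"
begin

abbreviation "poly_B \<equiv> mvpoly B m"
abbreviation "hvec \<equiv> horner_vec B m"
abbreviation "hrow \<equiv> hankel_row \<sigma> m"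

lemma horner_m: "horner B m w u m = u"
  by (simp add: horner_def monic)

lemma horner_zero: "horner B m w 0 k = 0"
  by (simp add: horner_def)

text \<open>The Horner recursion turns each summand into a difference f k - f (k + 1) minus a term
  of the recurrence. After telescoping, the boundary term f m supplies the missing top term, because
  B is monic. Thus Horner vectors solve (w H_0 + H_1) x = (first block column of H_0) B(w)
  u.\<close>

lemma row_hvec: "w *s hrow (hvec w u) j + hrow (hvec w u) (Suc j) = \<sigma> j *v poly_B w u"
proof -
  define f where "f k = (-1) ^ k *s (\<sigma> (j + k) *v horner B m w u k)" for k
  have "w *s hrow (hvec w u) j + hrow (hvec w u) (Suc j) =
      (\<Sum>k<m. w *s (\<sigma> (j + k) *v hvec w u k) + \<sigma> (Suc (j + k)) *v hvec w u k)"
    by (simp add: hankel_row_def vector_scale_sum sum.distrib)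
  also have "\<dots> = (\<Sum>k<m. (f k - f (Suc k)) - (-1) ^ k *s (\<sigma> (j + k) *v (B k *v u)))"
    by (intro sum.cong refl)
      (auto simp: f_def horner_vec_def horner_rec matrix_vector_right_distrib vector_scalar_commute
        vector_add_ldistrib vector_smult_assoc mult.commute vec_eq_iff)
  also have "\<dots> = f 0 - f m - (\<Sum>k<m. (-1) ^ k *s (\<sigma> (j + k) *v (B k *v u)))"
    by (subst sum_subtractf) (simp only: sum_lessThan_telescope')
  also have "\<dots> = f 0 - (\<Sum>k\<le>m. (-1) ^ k *s (\<sigma> (j + k) *v (B k *v u)))"
    by (simp add: f_def horner_m monic flip: lessThan_Suc_atMost)
  also have "\<dots> = \<sigma> j *v poly_B w u" by (simp add: recurrence f_def horner_0)
  finally show ?thesis .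
qed

section \<open>The companion operator and injectivity of the Hankel matrix\<close>

definition lead :: "(nat \<Rightarrow> complex^'p) \<Rightarrow> complex^'p" where
  "lead x = (-1) ^ (m - 1) *s x (m - 1)"

text \<open>The block companion matrix of B, conjugated by alternating signs and negated: an
  eigenvalue \<kappa> belongs to the root w = -\<kappa> of B. The sign in \<open>lead\<close> undoes
  the sign in the last block of a Horner vector, so that \<open>lead\<close> recovers u.\<close>

definition companion :: "(nat \<Rightarrow> complex^'p) \<Rightarrow> nat \<Rightarrow> complex^'p" where
  "companion x k =
     (if k < m then (if k = 0 then 0 else x (k - 1)) + (-1) ^ k *s (B k *v lead x) else 0)"

text \<open>The recurrence rewrites the terms with B_k, for k < m, as the last column of the next
  Hankel row. In matrix form H_0 C = H_1.\<close>

lemma row_companion: "hrow (companion x) j = hrow x (Suc j)"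
proof (cases m)
  case (Suc m')
  have "hrow (companion x) j = (\<Sum>k<m. \<sigma> (j + k) *v (if k = 0 then 0 else x (k - 1)))
      + (\<Sum>k<m. (-1) ^ k *s (\<sigma> (j + k) *v (B k *v lead x)))"
    by (simp add: hankel_row_def companion_def matrix_vector_right_distrib vector_scalar_commute sum.distrib)
  also have "(\<Sum>k<m. \<sigma> (j + k) *v (if k = 0 then 0 else x (k - 1))) = (\<Sum>k<m'. \<sigma> (Suc j + k) *v x k)"
    unfolding Suc by (subst sum.lessThan_Suc_shift) simp
  also have "(\<Sum>k<m. (-1) ^ k *s (\<sigma> (j + k) *v (B k *v lead x))) = - ((-1) ^ m *s (\<sigma> (j + m) *v lead x))"
    using recurrence[of j "lead x"] by (simp add: monic add_eq_0_iff2 flip: lessThan_Suc_atMost)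
  also have "lead x = (-1) ^ m' *s x m'" unfolding lead_def by (simp add: Suc)
  also have "- ((-1) ^ m *s (\<sigma> (j + m) *v ((-1) ^ m' *s x m'))) = \<sigma> (Suc j + m') *v x m'"
    by (simp add: Suc vector_scalar_commute vector_smult_assoc flip: power_add mult_2)
  finally show ?thesis by (simp add: hankel_row_def Suc)
qed (simp add: hankel_row_def)

text \<open>Back substitution from the last block: the equation in row k >= 1 determines block k -
  1, which reproduces the Horner scheme with u = \<open>lead x\<close>. The remaining equation in
  row 0 reads B(w) u = v.\<close>

lemma companion_resolvent:
  assumes x: "x \<in> block_space {..<m}" and m: "m > 0"
    and eq: "\<And>k. k < m \<Longrightarrow> w *s x k + companion x k = (if k = 0 then v else 0)"
  shows "x = hvec w (lead x)" and "poly_B w (lead x) = v"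
proof -
  have *: "x (m - Suc i) = (-1) ^ (m - Suc i) *s horner B m w (lead x) (m - i)" if "i < m" for i
    using that
  proof (induction i)
    case 0
    then show ?case by (simp add: horner_m lead_def vector_smult_assoc flip: power_add mult_2)
  next
    case (Suc i)
    define k where "k = m - Suc (Suc i)"
    have k: "Suc k < m" "m - Suc i = Suc k" "m - i = Suc (Suc k)" using Suc(2) by (auto simp: k_def)
    have "w *s x (Suc k) + (x k + (-1) ^ Suc k *s (B (Suc k) *v lead x)) = 0"
      using eq[OF k(1)] k(1) by (simp add: companion_def)
    moreover have "x (Suc k) = (-1) ^ Suc k *s horner B m w (lead x) (Suc (Suc k))"
      using Suc k by simp
    ultimately have "x k = (-1) ^ k *s (B (Suc k) *v lead x + w *s horner B m w (lead x) (Suc (Suc k)))"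
      by (auto simp: vec_eq_iff algebra_simps eq_neg_iff_add_eq_0)
    then show ?case unfolding k_def[symmetric] k(2) using k(1) by (simp add: horner_rec)
  qed
  have **: "x k = hvec w (lead x) k" if "k < m" for k
    using *[of "m - Suc k"] that by (simp add: horner_vec_def)
  then show "x = hvec w (lead x)"
    using x by (auto simp: block_space_def horner_vec_def fun_eq_iff)
  have "w *s x 0 + B 0 *v lead x = v" using eq[OF m] m by (simp add: companion_def)
  then show "poly_B w (lead x) = v"
    using **[OF m] m horner_rec[OF m, of B w "lead x"] by (simp add: horner_vec_def horner_0 add.commute)
qed

lemma hvec_zero: "hvec w 0 = 0"
  by (simp add: horner_vec_def horner_zero fun_eq_iff)

lemma companion_in: "companion x \<in> block_space {..<m}"
  by (simp add: block_space_def companion_def)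

lemma companion_add: "companion (x + y) = companion x + companion y"
  and companion_scale: "companion (block_scale c x) = block_scale c (companion x)"
  by (auto simp: fun_eq_iff companion_def lead_def block_scale_def matrix_vector_right_distrib
      vector_scalar_commute vector_add_ldistrib vector_smult_assoc mult.commute)

text \<open>The kernel is invariant under the companion operator, hence would contain an
  eigenvector of it, and such eigenvectors are exactly the common roots.\<close>
lemma hankel_inj:
  assumes herm: "\<And>k. k < 2 * m \<Longrightarrow> hermitian_mat (\<sigma> k)"
    and coprime: "\<And>w u. u \<noteq> 0 \<Longrightarrow> poly_B w u = 0 \<Longrightarrow> hrow (hvec w u) 0 \<noteq> 0"
    and x: "x \<in> block_space {..<m}" and ker: "\<And>j. j < m \<Longrightarrow> hrow x j = 0"
  shows "x = 0"
proof (rule ccontr)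
  assume "x \<noteq> 0"
  then have m: "m > 0" using x by (auto simp: block_space_def fun_eq_iff)
  define K where "K = {x \<in> block_space {..<m}. \<forall>j<m. hrow x j = 0}"
  have sub: "block.subspace K"
    unfolding K_def using block_space_subspace[of "{..<m}"]
    by (auto simp: block.subspace_def plus_fun_def hankel_row_add block_scale_def hankel_row_scale
        hankel_row_zero zero_fun_def)
  have inv: "companion y \<in> K" if y: "y \<in> K" for y
  proof -
    have "hrow y (Suc j) = 0" if j: "j < m" for j
    proof -
      \<comment> \<open>A test vector concentrated in block j. Since H_1 = H_0 C and both Hankel
        matrices are self-adjoint, <z, H_1 y> = <C z, H_0 y> = 0, while the left side is the squared
        norm of row j of H_1 y.\<close>
      define z where "z i = (if i = j then hrow y (Suc j) else 0)" for i
      have "cinner (hrow y (Suc j)) (hrow y (Suc j)) = (\<Sum>i<m. cinner (z i) (hrow y (Suc i)))"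
        unfolding z_def using j by (simp add: if_distrib[of "\<lambda>a. cinner a _"] cinner_zero_left cong: if_cong)
      also have "\<dots> = (\<Sum>i<m. cinner (hrow z (Suc i)) (y i))"
        using hankel_row_adjoint[of m "\<lambda>k. \<sigma> (Suc k)" z y] herm by (simp add: hankel_row_def)
      also have "\<dots> = (\<Sum>i<m. cinner (hrow (companion z) i) (y i))" by (simp add: row_companion)
      also have "\<dots> = (\<Sum>i<m. cinner (companion z i) (hrow y i))"
        using hankel_row_adjoint[of m \<sigma> "companion z" y] herm by simp
      also have "\<dots> = 0" using y by (simp add: K_def cinner_zero_right)
      finally show ?thesis by (simp add: cinner_self_eq_0)
    qed
    then show ?thesis by (simp add: K_def companion_in row_companion)
  qed
  interpret K: fin_dim_operator block_scale K "block_basis {..<m}" companion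
    by unfold_locales
      (use sub inv block_space_span[of "{..<m}"] in \<open>auto simp: companion_add companion_scale
         finite_block_basis K_def\<close>)
  have "x \<in> K" using x ker by (simp add: K_def)
  then obtain y \<kappa> where y: "y \<in> K" "y \<noteq> 0" "companion y = block_scale \<kappa> y"
    using K.eigenvector_exists \<open>x \<noteq> 0\<close> by blast
  have "y \<in> block_space {..<m}" using y by (simp add: K_def)
  moreover have "(-\<kappa>) *s y k + companion y k = (if k = 0 then 0 else 0)" for k
    by (simp add: y(3) block_scale_def vec_eq_iff)
  ultimately have "y = hvec (-\<kappa>) (lead y)" "poly_B (-\<kappa>) (lead y) = 0"
    using companion_resolvent[of y "-\<kappa>" 0] m by blast+
  moreover have "hrow y 0 = 0" using y(1) m by (simp add: K_def)
  ultimately show False using coprime y(2) hvec_zero by metis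
qed

end

section \<open>Comparison of coefficients in the Markov series\<close>

lemma powser_eq_0_imp_coeff_0:
  fixes e :: "nat \<Rightarrow> complex"
  assumes r: "r > 0" and sums: "\<And>z. z \<noteq> 0 \<Longrightarrow> norm z < r \<Longrightarrow> (\<lambda>n. e n * z ^ n) sums 0"
  shows "e n = 0"
proof (induction n rule: less_induct)
  case (less n)
  have s: "(\<lambda>k. e (k + n) * z ^ k) sums 0" if z: "z \<noteq> 0" "norm z < r" for z
  proof -
    have "(\<lambda>k. e (k + n) * z ^ (k + n)) sums 0"
      using sums_zero_iff_shift[of n "\<lambda>k. e k * z ^ k" 0] less sums[OF z] by simp
    from sums_divide[OF this, of "z ^ n"] show ?thesis using z by (simp add: power_add)
  qed
  have "((\<lambda>z::complex. 0) \<longlongrightarrow> e (0 + n)) (at 0)"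
    by (rule powser_limit_0_strong[where s = r and a = "\<lambda>k. e (k + n)"]) (use r s in auto)
  then show "e n = 0" using LIM_const_eq[of "0::complex" "e n" 0] by simp
qed

lemma mvpoly_eq:
  fixes B :: "nat \<Rightarrow> complex^'p^'p"
  shows "mvpoly B m w u = (\<Sum>i\<le>m. cmat_scale (w ^ i) (B i)) *v u"
proof -
  have "cmat_scale c M *v u = c *s (M *v u)" for c and M :: "complex^'p^'p"
    by (simp add: cmat_scale_def matrix_vector_mult_def vec_eq_iff sum_distrib_left mult.assoc)
  moreover have "(\<Sum>i\<in>S. f i) *v u = (\<Sum>i\<in>S. f i *v u)" for f :: "nat \<Rightarrow> complex^'p^'p" and S
    by (induction S rule: infinite_finite_induct) (auto simp: matrix_vector_mult_add_rdistrib)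
  ultimately show ?thesis by (simp add: mvpoly_def)
qed

text \<open>Multiplying N(w) B(w) u = C(w) u by z^m with z = 1 / w gives an identity of power series
  in z. Exponents above m yield the recurrence; exponents up to m express the coefficients of C
  through \<sigma> and B.\<close>

lemma markov_series_coeffs:
  fixes B C \<sigma> :: "nat \<Rightarrow> complex^'p^'p"
  assumes series: "\<And>w. R < norm w \<Longrightarrow> invertible (\<Sum>i\<le>m. cmat_scale (w ^ i) (B i)) \<and>
      (\<lambda>k. cmat_scale ((-1) ^ k / w ^ (k + 1)) (\<sigma> k)) sums
        ((\<Sum>i\<le>m. cmat_scale (w ^ i) (C i)) ** matrix_inv (\<Sum>i\<le>m. cmat_scale (w ^ i) (B i)))"
  shows "(\<Sum>i\<le>m. (-1) ^ i *s (\<sigma> (j + i) *v (B i *v u))) = 0"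
    and "mvpoly C m w u = hankel_row \<sigma> m (horner_vec B m w u) 0"
proof -
  define g where "g a i k = (\<sigma> k *v (B i *v u)) $ a" for a i k
  \<comment> \<open>The coefficient of z^n in component a of z^m w^i N(w) B_i u. Its series starts
    at exponent m + 1 - i, because N starts with 1 / w. Correspondingly \<open>d\<close> holds the
    coefficients of z^m C(w) u.\<close>
  define c where "c a i n = (if n < Suc m - i then 0
      else (-1) ^ (n - (Suc m - i)) * g a i (n - (Suc m - i)))" for a i n
  define d where "d a n = (if n \<le> m then (C (m - n) *v u) $ a else 0)" for a n
  have coeffs: "(\<Sum>i\<le>m. c a i n) - d a n = 0" for a n
  \<comment> \<open>The maximum with 1 keeps the radius positive when R <= 0.\<close>
  proof (rule powser_eq_0_imp_coeff_0[where r = "1 / max R 1"])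
    show "1 / max R 1 > 0" by simp
  next
    fix z :: complex assume z: "z \<noteq> 0" "norm z < 1 / max R 1"
    define w where "w = 1 / z"
    have w: "w \<noteq> 0" "z = 1 / w" using z by (auto simp: w_def)
    have "max R 1 < norm w"
      using z by (simp add: w_def norm_divide pos_less_divide_eq mult.commute del: max_less_iff_conj)
    then have Rw: "R < norm w" by simp
    define FB where "FB = (\<Sum>i\<le>m. cmat_scale (w ^ i) (B i))"
    define FC where "FC = (\<Sum>i\<le>m. cmat_scale (w ^ i) (C i))"
    define N where "N = FC ** matrix_inv FB"
    have "invertible FB" using series[OF Rw] by (simp add: FB_def)
    then have "matrix_inv FB ** FB = mat 1"
      unfolding invertible_def matrix_inv_def by (rule someI2_ex) blast
    then have NFB: "N *v (FB *v u) = FC *v u"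
      by (simp add: N_def matrix_vector_mul_assoc flip: matrix_mul_assoc)
    have ent: "(\<lambda>k. (-1) ^ k / w ^ (k + 1) * \<sigma> k $ a $ b) sums N $ a $ b" for b
    proof -
      have "(\<lambda>k. cmat_scale ((-1) ^ k / w ^ (k + 1)) (\<sigma> k)) sums N"
        using series[OF Rw] by (simp add: N_def FB_def FC_def)
      from bounded_linear.sums[OF bounded_linear_vec_nth bounded_linear.sums[OF bounded_linear_vec_nth this]]
      show ?thesis by (simp add: cmat_scale_def)
    qed
    have vec: "(\<lambda>k. (-1) ^ k / w ^ (k + 1) * (\<sigma> k *v y) $ a) sums (N *v y) $ a" for y
      using sums_sum[of UNIV "\<lambda>b k. (-1) ^ k / w ^ (k + 1) * \<sigma> k $ a $ b * y $ b"
          "\<lambda>b. N $ a $ b * y $ b"] sums_mult2[OF ent]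
      by (simp add: matrix_vector_mult_def sum_distrib_left mult.assoc)
    have "(\<lambda>n. c a i n * z ^ n) sums (z ^ m * w ^ i * (N *v (B i *v u)) $ a)" if "i \<le> m" for i
    proof -
      have "(\<lambda>k. z ^ m * w ^ i * ((-1) ^ k / w ^ (k + 1) * g a i k)) sums
          (z ^ m * w ^ i * (N *v (B i *v u)) $ a)"
        unfolding g_def by (intro sums_mult vec)
      moreover have "z ^ m * w ^ i * ((-1) ^ k / w ^ (k + 1) * g a i k) =
          c a i (k + (Suc m - i)) * z ^ (k + (Suc m - i))" for k
      proof -
        define e where "e = m - i"
        have e: "Suc m - i = Suc e" using that by (simp add: e_def Suc_diff_le)
        have "z ^ m = z ^ e * z ^ i" using that by (simp add: e_def flip: power_add)
        then have "z ^ m * w ^ i = z ^ e"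
          using w by (simp flip: power_mult_distrib)
        then show ?thesis unfolding c_def e by (simp add: power_add w(2) power_divide)
      qed
      ultimately have "(\<lambda>k. c a i (k + (Suc m - i)) * z ^ (k + (Suc m - i))) sums
          (z ^ m * w ^ i * (N *v (B i *v u)) $ a)" by simp
      then show ?thesis
        by (subst (asm) sums_zero_iff_shift[of _ "\<lambda>n. c a i n * z ^ n"]) (auto simp: c_def)
    qed
    then have "(\<lambda>n. \<Sum>i\<le>m. c a i n * z ^ n) sums (\<Sum>i\<le>m. z ^ m * w ^ i * (N *v (B i *v u)) $ a)"
      by (intro sums_sum) auto
    moreover have "(\<Sum>i\<le>m. z ^ m * w ^ i * (N *v (B i *v u)) $ a) = z ^ m * (N *v (FB *v u)) $ a"
      unfolding FB_def mvpoly_eq[symmetric] mvpoly_def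
      by (simp add: matrix_vector_mult_sum vector_scalar_commute sum_distrib_left mult.assoc)
    moreover have "z ^ m * (FC *v u) $ a = (\<Sum>n\<le>m. d a n * z ^ n)"
    proof -
      have "z ^ m * (FC *v u) $ a = (\<Sum>i\<le>m. z ^ m * (w ^ i * (C i *v u) $ a))"
        unfolding FC_def mvpoly_eq[symmetric] mvpoly_def by (simp add: sum_distrib_left)
      also have "\<dots> = (\<Sum>i\<le>m. d a (m - i) * z ^ (m - i))"
      proof (intro sum.cong refl)
        fix i assume "i \<in> {..m}"
        then have i: "i \<le> m" by simp
        then have "z ^ m = z ^ (m - i) * z ^ i" by (simp flip: power_add)
        then have "z ^ m * w ^ i = z ^ (m - i)"
          using w by (simp flip: power_mult_distrib)
        then show "z ^ m * (w ^ i * (C i *v u) $ a) = d a (m - i) * z ^ (m - i)"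
          using i by (simp add: d_def flip: mult.assoc)
      qed
      also have "\<dots> = (\<Sum>n\<le>m. d a n * z ^ n)"
        by (rule sum.reindex_bij_witness[of _ "\<lambda>n. m - n" "\<lambda>n. m - n"]) auto
      finally show ?thesis .
    qed
    ultimately have "(\<lambda>n. \<Sum>i\<le>m. c a i n * z ^ n) sums (\<Sum>n\<le>m. d a n * z ^ n)"
      by (simp add: NFB)
    moreover have "(\<lambda>n. d a n * z ^ n) sums (\<Sum>n\<le>m. d a n * z ^ n)"
      by (rule sums_finite) (auto simp: d_def)
    ultimately show "(\<lambda>n. ((\<Sum>i\<le>m. c a i n) - d a n) * z ^ n) sums 0"
      using sums_diff by (fastforce simp: left_diff_distrib sum_distrib_right)
  qed
  show "(\<Sum>i\<le>m. (-1) ^ i *s (\<sigma> (j + i) *v (B i *v u))) = 0"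
  proof (rule vec_eq_iff[THEN iffD2], rule allI)
    fix a
    have "(\<Sum>i\<le>m. c a i (Suc m + j)) = (\<Sum>i\<le>m. (-1) ^ j * ((-1) ^ i * g a i (j + i)))"
      by (intro sum.cong refl) (auto simp: c_def algebra_simps simp flip: power_add)
    then have "(-1) ^ j * (\<Sum>i\<le>m. (-1) ^ i * g a i (j + i)) = 0"
      using coeffs[of a "Suc m + j"] by (simp add: d_def sum_distrib_left)
    then show "(\<Sum>i\<le>m. (-1) ^ i *s (\<sigma> (j + i) *v (B i *v u))) $ a = 0 $ a"
      by (simp add: g_def)
  qed
  \<comment> \<open>These are the exponents n = m - l. Summing over l with weights w^l and
    collecting by k = i - l - 1 produces the Horner blocks paired with the first Hankel row.\<close>
  have C: "C l *v u = (\<Sum>i\<in>{Suc l..m}. (-1) ^ (i - Suc l) *s (\<sigma> (i - Suc l) *v (B i *v u)))"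
    if "l \<le> m" for l
  proof (rule vec_eq_iff[THEN iffD2], rule allI)
    fix a
    have "(C l *v u) $ a = (\<Sum>i\<le>m. c a i (m - l))"
      using coeffs[of a "m - l"] that by (simp add: d_def)
    also have "\<dots> = (\<Sum>i\<in>{Suc l..m}. c a i (m - l))"
      by (rule sum.mono_neutral_right) (use that in \<open>auto simp: c_def\<close>)
    also have "\<dots> = (\<Sum>i\<in>{Suc l..m}. (-1) ^ (i - Suc l) * g a i (i - Suc l))"
    proof (intro sum.cong refl)
      fix i assume "i \<in> {Suc l..m}"
      then have "\<not> m - l < Suc m - i" "m - l - (Suc m - i) = i - Suc l" by auto
      then show "c a i (m - l) = (-1) ^ (i - Suc l) * g a i (i - Suc l)" by (simp add: c_def)
    qed
    finally show "(C l *v u) $ a =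
        (\<Sum>i\<in>{Suc l..m}. (-1) ^ (i - Suc l) *s (\<sigma> (i - Suc l) *v (B i *v u))) $ a"
      by (simp add: g_def)
  qed
  have "mvpoly C m w u = (\<Sum>l\<le>m. \<Sum>i\<in>{Suc l..m}.
      (w ^ l * (-1) ^ (i - Suc l)) *s (\<sigma> (i - Suc l) *v (B i *v u)))"
    unfolding mvpoly_def by (intro sum.cong refl) (simp add: C vector_scale_sum vector_smult_assoc)
  also have "\<dots> = (\<Sum>k<m. \<Sum>i\<in>{Suc k..m}. (w ^ (i - Suc k) * (-1) ^ k) *s (\<sigma> k *v (B i *v u)))"
    unfolding sum.Sigma[OF finite_atMost ballI[OF finite_atLeastAtMost]]
      sum.Sigma[OF finite_lessThan ballI[OF finite_atLeastAtMost]]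
    by (rule sum.reindex_bij_witness[of _ "\<lambda>(k, i). (i - Suc k, i)" "\<lambda>(l, i). (i - Suc l, i)"]) auto
  also have "\<dots> = hankel_row \<sigma> m (horner_vec B m w u) 0"
    by (auto simp: hankel_row_def horner_vec_def horner_def vector_scale_sum matrix_vector_mult_sum
        vector_scalar_commute vector_smult_assoc mult.commute intro!: sum.cong)
  finally show "mvpoly C m w u = hankel_row \<sigma> m (horner_vec B m w u) 0" .
qed

section \<open>Even degree\<close>

definition hankel_form :: "(nat \<Rightarrow> complex^'p^'p) \<Rightarrow> nat \<Rightarrow> (nat \<Rightarrow> complex^'p) \<Rightarrow> complex" where
  "hankel_form \<sigma> m x = (\<Sum>j<m. cinner (x j) (hankel_row \<sigma> m x j))"

text \<open>Only the real part is constrained, since Hermitian coefficients make the form real; on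
  such sequences this is positive definiteness.\<close>

definition hankel_pos :: "(nat \<Rightarrow> complex^'p^'p) \<Rightarrow> nat \<Rightarrow> bool" where
  "hankel_pos \<sigma> m \<longleftrightarrow> (\<forall>x. (\<exists>j<m. x j \<noteq> 0) \<longrightarrow> Re (hankel_form \<sigma> m x) > 0)"

lemma Im_hankel_form:
  assumes "\<And>k. k < 2 * m - 1 \<Longrightarrow> hermitian_mat (\<sigma> k)"
  shows "Im (hankel_form \<sigma> m x) = 0"
proof -
  have "hankel_form \<sigma> m x = cnj (hankel_form \<sigma> m x)"
    using hankel_row_adjoint[of m \<sigma> x x] assms by (simp add: hankel_form_def cnj_cinner)
  then show ?thesis by (metis add.inverse_inverse cnj.sel(2) neg_equal_zero)
qed

text \<open>If Re z >= 0, the imaginary part of the equation forces z to be real, and then every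
  term is nonnegative and c > 0. The value a = 0 must be allowed: in degree 1 one of the two Hankel
  forms is empty.\<close>

lemma quadratic_root_left_half_plane:
  assumes "of_real a * z\<^sup>2 + of_real b * z + of_real c = 0" "a \<ge> 0" "b > 0" "c > 0"
  shows "Re z < 0"
proof (rule ccontr)
  assume x: "\<not> Re z < 0"
  have re: "a * ((Re z)\<^sup>2 - (Im z)\<^sup>2) + b * Re z + c = 0"
    and im: "Im z * (2 * a * Re z + b) = 0"
    using assms(1) by (simp_all add: complex_eq_iff power2_eq_square algebra_simps)
  have "2 * a * Re z + b > 0" using assms x by (intro add_nonneg_pos) auto
  with im have "Im z = 0" by simp
  moreover have "a * (Re z)\<^sup>2 + b * Re z + c > 0" using assms x by (intro add_nonneg_pos) auto
  ultimately show False using re by simp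
qed

lemma Re_eq_of_cnj_eq: "cnj a = b \<Longrightarrow> Re a = Re b"
  by auto

lemma block_inner_Plus: "finite S \<Longrightarrow> finite S' \<Longrightarrow> block_inner (S <+> S') u v =
    (\<Sum>i\<in>S. cinner (u (Inl i)) (v (Inl i))) + (\<Sum>i\<in>S'. cinner (u (Inr i)) (v (Inr i)))"
  by (simp add: block_inner_def sum.Plus)

context monic_hankel
begin

text \<open>The converse of \<open>row_hvec\<close>. Since H_1 = H_0 C, the hypothesis says that H_0
  annihilates (w + C) x - (v, 0, ..., 0); injectivity of H_0 then leaves the companion equation. For
  m = 0 there is no block to hold v, so that case is separate.\<close>

lemma resolvent_lift:
  assumes inj: "\<And>x. x \<in> block_space {..<m} \<Longrightarrow> (\<And>j. j < m \<Longrightarrow> hrow x j = 0) \<Longrightarrow> x = 0"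
    and x: "x \<in> block_space {..<m}"
    and eq: "\<And>j. j < m \<Longrightarrow> w *s hrow x j + hrow x (Suc j) = \<sigma> j *v v"
  obtains u where "x = hvec w u" "poly_B w u = v"
proof (cases "m = 0")
  case True
  have "x = hvec w v" using x True by (auto simp: block_space_def horner_vec_def)
  moreover have "poly_B w v = v" using True monic by (simp add: mvpoly_def)
  ultimately show ?thesis using that by blast
next
  case False
  define e where "e k = (if k = 0 then v else 0)" for k :: nat
  have e: "hrow e j = \<sigma> j *v v" for j
    using False by (simp add: hankel_row_def e_def if_distrib[of "(*v) _"] cong: if_cong)
  define d where "d = (\<lambda>k. w *s x k + companion x k - e k)"
  have "d = 0"
  proof (rule inj)
    show "d \<in> block_space {..<m}"
      using x companion_in[of x] False by (auto simp: d_def e_def block_space_def)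
    show "hrow d j = 0" if "j < m" for j
      unfolding d_def hankel_row_diff hankel_row_add hankel_row_scale
      using eq[OF that] by (simp add: row_companion e)
  qed
  then have "w *s x k + companion x k = (if k = 0 then v else 0)" for k
    by (simp add: d_def e_def fun_eq_iff)
  then show ?thesis using that companion_resolvent[OF x] False by blast
qed

lemma hvec_last: "m > 0 \<Longrightarrow> hvec w u (m - 1) = (-1) ^ (m - 1) *s u"
  by (simp add: horner_vec_def horner_m)

lemma hvec_nonzero:
  assumes "m > 0" "u \<noteq> 0"
  shows "\<exists>j<m. hvec w u j \<noteq> 0"
  using assms hvec_last[OF assms(1), of w u] by (intro exI[of _ "m - 1"]) (simp add: vector_mul_eq_0)

text \<open>Let r_0 be the first row of H_0 x, which in the application is F_o(z^2) u. By
  \<open>row_hvec\<close> and the root equation, (z^2 H_0 + H_1) x is the first block column of H_0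
  times -z r_0. Pairing with x gives -z |r_0|^2, so b = |r_0|^2.\<close>

lemma root_left_half_plane_even:
  assumes herm: "\<And>k. k < 2 * m \<Longrightarrow> hermitian_mat (\<sigma> k)"
    and pos: "hankel_pos \<sigma> m" "hankel_pos (\<lambda>k. \<sigma> (Suc k)) m"
    and u: "u \<noteq> 0" and root: "poly_B (z\<^sup>2) u + z *s hrow (hvec (z\<^sup>2) u) 0 = 0"
  shows "Re z < 0"
proof -
  have m: "m > 0"
  proof (rule ccontr)
    assume "\<not> m > 0"
    then show False using root u monic by (simp add: mvpoly_def hankel_row_def)
  qed
  define x where "x = hvec (z\<^sup>2) u"
  define r where "r = hrow x"
  have x0: "\<exists>j<m. x j \<noteq> 0" unfolding x_def by (rule hvec_nonzero[OF m u])
  have step: "z\<^sup>2 *s r j + r (Suc j) = \<sigma> j *v poly_B (z\<^sup>2) u" for j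
    unfolding r_def x_def by (rule row_hvec)
  have root': "poly_B (z\<^sup>2) u = - (z *s r 0)"
    using root by (simp add: r_def x_def eq_neg_iff_add_eq_0)
  define a where "a = Re (hankel_form \<sigma> m x)"
  define c where "c = Re (hankel_form (\<lambda>k. \<sigma> (Suc k)) m x)"
  define b where "b = Re (cinner (r 0) (r 0))"
  have a: "hankel_form \<sigma> m x = of_real a" "a > 0"
    using Im_hankel_form[of m \<sigma> x] herm pos(1) x0
    by (auto simp: a_def hankel_pos_def complex_eq_iff)
  have c: "hankel_form (\<lambda>k. \<sigma> (Suc k)) m x = of_real c" "c > 0"
    using Im_hankel_form[of m "\<lambda>k. \<sigma> (Suc k)" x] herm pos(2) x0
    by (auto simp: c_def hankel_pos_def complex_eq_iff)
  have b: "cinner (r 0) (r 0) = of_real b" "b \<ge> 0"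
    by (auto simp: b_def complex_eq_iff Im_cinner_self Re_cinner_self_nonneg)
  have "z\<^sup>2 * hankel_form \<sigma> m x + hankel_form (\<lambda>k. \<sigma> (Suc k)) m x
      = (\<Sum>j<m. cinner (x j) (z\<^sup>2 *s r j + r (Suc j)))"
    by (simp add: hankel_form_def r_def cinner_add_right cinner_scale_right sum.distrib
        sum_distrib_left hankel_row_def)
  also have "\<dots> = (\<Sum>j<m. cinner (\<sigma> j *v x j) (poly_B (z\<^sup>2) u))"
    unfolding step by (intro sum.cong refl cinner_hermitian_mat herm) simp
  also have "\<dots> = cinner (r 0) (poly_B (z\<^sup>2) u)"
    by (simp add: r_def hankel_row_def cinner_sum_left)
  also have "\<dots> = - z * b"
    unfolding root' by (simp add: cinner_minus_right cinner_scale_right b)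
  finally have quad: "of_real a * z\<^sup>2 + of_real b * z + of_real c = 0"
    unfolding a c by (simp add: eq_neg_iff_add_eq_0 ac_simps)
  \<comment> \<open>If r_0 = 0, the root equation gives B(z^2) u = 0, and \<open>row_hvec\<close>
    passes the zero from each row to the next; then H_0 x = 0, against a > 0.\<close>
  have "b \<noteq> 0"
  proof
    assume "b = 0"
    then have r0: "r 0 = 0" using b by (simp add: cinner_self_eq_0)
    then have "poly_B (z\<^sup>2) u = 0" using root' by simp
    then have "r (Suc j) = 0" if "r j = 0" for j using step[of j] that by simp
    then have "r j = 0" for j by (induction j) (use r0 in auto)
    then show False using a by (simp add: hankel_form_def r_def cinner_zero_right)
  qed
  then show ?thesis using quadratic_root_left_half_plane[OF quad] a b c by simp
qed

text \<open>A common kernel vector at w would make the principal square root of w an admissible z,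
  but its real part is nonnegative.\<close>

lemma hankel_inj_of_no_root:
  assumes herm: "\<And>k. k < 2 * m \<Longrightarrow> hermitian_mat (\<sigma> k)"
    and hurw: "\<And>z u. u \<noteq> 0 \<Longrightarrow> poly_B (z\<^sup>2) u = 0 \<Longrightarrow> hrow (hvec (z\<^sup>2) u) 0 = 0 \<Longrightarrow> Re z < 0"
    and x: "x \<in> block_space {..<m}" and ker: "\<And>j. j < m \<Longrightarrow> hrow x j = 0"
  shows "x = 0"
proof (rule hankel_inj[OF herm _ x ker])
  fix w u assume "u \<noteq> 0" "poly_B w u = 0"
  then show "hrow (hvec w u) 0 \<noteq> 0"
    using hurw[of u "csqrt w"] csqrt_principal[of w] by force
qed

lemma hankel_pos_even:
  assumes herm: "\<And>k. k < 2 * m \<Longrightarrow> hermitian_mat (\<sigma> k)"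
    and hurw: "\<And>z u. u \<noteq> 0 \<Longrightarrow> poly_B (z\<^sup>2) u + z *s hrow (hvec (z\<^sup>2) u) 0 = 0 \<Longrightarrow> Re z < 0"
  shows "hankel_pos \<sigma> m" and "hankel_pos (\<lambda>k. \<sigma> (Suc k)) m"
proof -
  \<comment> \<open>Eliminating y = z x from z P (x, y) = G (x, y) leaves z^2 H_0 + z b b^* + H_1, where
    H_0 and H_1 are the two Hankel matrices and b is the first block column of H_0.\<close>
  define I :: "(nat + nat) set" where "I = {..<m} <+> {..<m}"
  \<comment> \<open>The oscillator H_0 x'' + b b^* x' + H_1 x = 0 in the state (x, x'), with the
    trivial equation multiplied by H_1. Then the energy is the sum of both forms, the couplings in G
    are skew, and only the damping b b^* contributes to the real part.\<close>
  define P where "P v = case_sum (\<lambda>j. if j < m then hrow (\<lambda>i. v (Inl i)) (Suc j) else 0)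
      (\<lambda>j. if j < m then hrow (\<lambda>i. v (Inr i)) j else 0)" for v :: "nat + nat \<Rightarrow> complex^'p"
  define G where "G v = case_sum (\<lambda>j. if j < m then hrow (\<lambda>i. v (Inr i)) (Suc j) else 0)
      (\<lambda>j. if j < m then - hrow (\<lambda>i. v (Inl i)) (Suc j) - \<sigma> j *v hrow (\<lambda>i. v (Inr i)) 0 else 0)"
    for v :: "nat + nat \<Rightarrow> complex^'p"
  have inj0: "x = 0" if "x \<in> block_space {..<m}" "\<And>j. j < m \<Longrightarrow> hrow x j = 0" for x
    by (rule hankel_inj_of_no_root[OF herm _ that]) (use hurw in auto)
  \<comment> \<open>At w = 0 a kernel vector of H_1 lifts to some u with F(0) u = 0, and 0 is not in
    the open left half-plane.\<close>
  have inj1: "x = 0" if x: "x \<in> block_space {..<m}" and ker: "\<And>j. j < m \<Longrightarrow> hrow x (Suc j) = 0" for x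
  proof -
    obtain u where u: "x = hvec 0 u" "poly_B 0 u = 0"
      by (rule resolvent_lift[OF inj0 x, of 0 0]) (simp_all add: ker)
    have "u = 0" using hurw[of u 0] u by auto
    then show ?thesis using u hvec_zero by simp
  qed
  have adj1: "(\<Sum>j<m. cinner (x j) (hrow y (Suc j))) = (\<Sum>j<m. cinner (hrow x (Suc j)) (y j))" for x y
    using hankel_row_adjoint[of m "\<lambda>k. \<sigma> (Suc k)" x y] herm by (simp add: hankel_row_def)
  have adj0: "(\<Sum>j<m. cinner (x j) (hrow y j)) = (\<Sum>j<m. cinner (hrow x j) (y j))" for x y
    using hankel_row_adjoint[of m \<sigma> x y] herm by simp
  have inl: "(\<lambda>i. v (Inl i)) \<in> block_space {..<m}" and inr: "(\<lambda>i. v (Inr i)) \<in> block_space {..<m}"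
    if "v \<in> block_space I" for v :: "nat + nat \<Rightarrow> complex^'p"
    using that by (auto simp: block_space_def I_def)
  have sum0: "v = 0" if "(\<lambda>i. v (Inl i)) = (\<lambda>i. 0)" "(\<lambda>i. v (Inr i)) = (\<lambda>i. 0)"
    for v :: "nat + nat \<Rightarrow> complex^'p"
  proof
    fix i show "v i = 0 i" using that by (cases i) (auto simp: fun_eq_iff)
  qed
  interpret block_pencil I P G
  proof
    fix v :: "nat + nat \<Rightarrow> complex^'p" assume v: "v \<in> block_space I" "P v = 0"
    have P0: "hrow (\<lambda>i. v (Inl i)) (Suc j) = 0" "hrow (\<lambda>i. v (Inr i)) j = 0" if "j < m" for j
      using fun_cong[OF v(2), of "Inl j"] fun_cong[OF v(2), of "Inr j"] that by (simp_all add: P_def)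
    have "(\<lambda>i. v (Inl i)) = 0" by (rule inj1[OF inl[OF v(1)] P0(1)])
    moreover have "(\<lambda>i. v (Inr i)) = 0" by (rule inj0[OF inr[OF v(1)] P0(2)])
    ultimately show "v = 0" by (intro sum0[of v]) (simp_all add: zero_fun_def)
  next
    fix u v :: "nat + nat \<Rightarrow> complex^'p"
    show "block_inner I u (P v) = block_inner I (P u) v"
      unfolding I_def by (simp add: block_inner_Plus P_def adj0 adj1)
  next
    fix v :: "nat + nat \<Rightarrow> complex^'p"
    let ?x = "\<lambda>i. v (Inl i)" and ?y = "\<lambda>i. v (Inr i)"
    have "block_inner I v (G v) = (\<Sum>j<m. cinner (?x j) (hrow ?y (Suc j)))
        - (\<Sum>j<m. cinner (?y j) (hrow ?x (Suc j))) - (\<Sum>j<m. cinner (?y j) (\<sigma> j *v hrow ?y 0))"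
      unfolding I_def by (simp add: block_inner_Plus G_def cinner_diff_right cinner_minus_right
          sum_subtractf sum_negf)
    moreover have "cnj (\<Sum>j<m. cinner (?x j) (hrow ?y (Suc j))) = (\<Sum>j<m. cinner (?y j) (hrow ?x (Suc j)))"
      by (simp add: cnj_cinner adj1)
    from Re_eq_of_cnj_eq[OF this]
    have "Re (\<Sum>j<m. cinner (?x j) (hrow ?y (Suc j))) = Re (\<Sum>j<m. cinner (?y j) (hrow ?x (Suc j)))" .
    moreover have "(\<Sum>j<m. cinner (?y j) (\<sigma> j *v hrow ?y 0)) = (\<Sum>j<m. cinner (\<sigma> j *v ?y j) (hrow ?y 0))"
      by (intro sum.cong refl cinner_hermitian_mat herm) simp
    then have "(\<Sum>j<m. cinner (?y j) (\<sigma> j *v hrow ?y 0)) = cinner (hrow ?y 0) (hrow ?y 0)"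
      by (simp add: hankel_row_def flip: cinner_sum_left)
    ultimately show "Re (block_inner I v (G v)) \<le> 0"
      using Re_cinner_self_nonneg[of "hrow ?y 0"] by simp
  next
    fix v :: "nat + nat \<Rightarrow> complex^'p" and \<kappa>
    let ?x = "\<lambda>i. v (Inl i)" and ?y = "\<lambda>i. v (Inr i)"
    assume v: "v \<in> block_space I" "v \<noteq> 0" and eq: "block_scale \<kappa> (P v) = G v"
    have eq1: "\<kappa> *s hrow ?x (Suc j) = hrow ?y (Suc j)"
      and eq2: "\<kappa> *s hrow ?y j = - hrow ?x (Suc j) - \<sigma> j *v hrow ?y 0" if "j < m" for j
      using fun_cong[OF eq, of "Inl j"] fun_cong[OF eq, of "Inr j"] that
      by (simp_all add: block_scale_def P_def G_def)
    have "(\<lambda>i. \<kappa> *s ?x i - ?y i) = 0"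
    proof (rule inj1)
      show "(\<lambda>i. \<kappa> *s ?x i - ?y i) \<in> block_space {..<m}"
        using inl[OF v(1)] inr[OF v(1)] by (simp add: block_space_def)
      show "hrow (\<lambda>i. \<kappa> *s ?x i - ?y i) (Suc j) = 0" if "j < m" for j
        using eq1[OF that] by (simp add: hankel_row_diff hankel_row_scale)
    qed
    then have y: "?y = (\<lambda>i. \<kappa> *s ?x i)" by (simp add: fun_eq_iff)
    have "\<kappa>\<^sup>2 *s hrow ?x j + hrow ?x (Suc j) = \<sigma> j *v (- (\<kappa> *s hrow ?x 0))" if "j < m" for j
      using eq2[OF that] unfolding y
      by (simp add: hankel_row_scale vector_smult_assoc power2_eq_square matrix_vector_mult_minus)
    then obtain u where u: "?x = hvec (\<kappa>\<^sup>2) u" "poly_B (\<kappa>\<^sup>2) u = - (\<kappa> *s hrow ?x 0)"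
      using resolvent_lift[OF inj0 inl[OF v(1)], of "\<kappa>\<^sup>2"] by metis
    have "u \<noteq> 0"
    proof
      assume "u = 0"
      then have "?x = (\<lambda>i. 0)" using u(1) hvec_zero by (simp add: zero_fun_def)
      then show False using sum0[of v] y v(2) by (simp add: fun_eq_iff)
    qed
    then show "Re \<kappa> < 0" by (rule hurw) (use u in simp)
  qed (auto simp: I_def P_def G_def block_space_def fun_eq_iff hankel_row_add hankel_row_scale
      block_scale_def matrix_vector_right_distrib vector_scalar_commute vector_add_ldistrib
      vector_ssub_ldistrib vector_smult_rneg split: sum.split)
  show "hankel_pos \<sigma> m" unfolding hankel_pos_def
  proof (intro allI impI)
    fix x :: "nat \<Rightarrow> complex^'p" assume x: "\<exists>j<m. x j \<noteq> 0"
    define v where "v = case_sum (\<lambda>j::nat. 0) (\<lambda>j. if j < m then x j else 0)"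
    have "v \<in> block_space I" by (auto simp: v_def block_space_def I_def split: sum.split)
    moreover have "v \<noteq> 0" using x by (auto simp: v_def fun_eq_iff split: sum.split)
    ultimately have "energy v > 0" by (rule energy_pos)
    moreover have "block_inner I v (P v) = hankel_form \<sigma> m x"
      by (simp add: I_def block_inner_Plus v_def P_def hankel_form_def cinner_zero_left hankel_row_def)
    ultimately show "Re (hankel_form \<sigma> m x) > 0" by simp
  qed
  show "hankel_pos (\<lambda>k. \<sigma> (Suc k)) m" unfolding hankel_pos_def
  proof (intro allI impI)
    fix x :: "nat \<Rightarrow> complex^'p" assume x: "\<exists>j<m. x j \<noteq> 0"
    define v where "v = case_sum (\<lambda>j. if j < m then x j else 0) (\<lambda>j::nat. 0)"
    have "v \<in> block_space I" by (auto simp: v_def block_space_def I_def split: sum.split)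
    moreover have "v \<noteq> 0" using x by (auto simp: v_def fun_eq_iff split: sum.split)
    ultimately have "energy v > 0" by (rule energy_pos)
    moreover have "block_inner I v (P v) = hankel_form (\<lambda>k. \<sigma> (Suc k)) m x"
      by (simp add: I_def block_inner_Plus v_def P_def hankel_form_def cinner_zero_left hankel_row_def)
    ultimately show "Re (hankel_form (\<lambda>k. \<sigma> (Suc k)) m x) > 0" by simp
  qed
qed

end

section \<open>Odd degree\<close>

text \<open>In odd degree F_e F_o^-1 tends to s_0 at infinity, and s_0 - F_e F_o^-1 has an ordinary
  Markov series with parameters s_1, s_2, .... Hence B is F_o and the sequence is shifted by
  one.\<close>

locale monic_hankel_shifted = monic_hankel m B "\<lambda>k. s (Suc k)"
  for m :: nat and B s :: "nat \<Rightarrow> complex^'p^'p" +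
  assumes herm: "k \<le> 2 * m \<Longrightarrow> hermitian_mat (s k)"
begin

abbreviation "srow \<equiv> hankel_row s (Suc m)"

text \<open>In the application this is F_e(w) u: the subtracted row is the numerator s_0 F_o - F_e
  of the shifted series, applied to u.\<close>

definition even_poly :: "complex \<Rightarrow> complex^'p \<Rightarrow> complex^'p" where
  "even_poly w u = s 0 *v poly_B w u - hrow (hvec w u) 0"

lemma srow_split: "srow y j = s j *v y 0 + hrow (\<lambda>k. y (Suc k)) j"
  unfolding hankel_row_def by (subst sum.lessThan_Suc_shift) simp

text \<open>With v = B(z^2) u, put v in front of the negated Horner vector x. On y = (v, -x), row 0
  of the larger Hankel matrix is -z v by the root equation, and row j + 1 is z^2 times row j of the
  smaller one by \<open>row_hvec\<close>. Pairing with y gives the quadratic with b = |v|^2.\<close>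

lemma root_left_half_plane_odd:
  assumes pos: "hankel_pos s (Suc m)" "hankel_pos (\<lambda>k. s (Suc k)) m"
    and u: "u \<noteq> 0" and root: "even_poly (z\<^sup>2) u + z *s poly_B (z\<^sup>2) u = 0"
  shows "Re z < 0"
proof -
  define x where "x = hvec (z\<^sup>2) u"
  define v where "v = poly_B (z\<^sup>2) u"
  define y where "y k = (case k of 0 \<Rightarrow> v | Suc i \<Rightarrow> - x i)" for k
  have y0: "\<exists>j<Suc m. y j \<noteq> 0"
  proof (cases "m = 0")
    case True
    then have "v = u" using monic by (simp add: v_def mvpoly_def)
    then show ?thesis using u by (auto simp: y_def)
  next
    case False
    then obtain j where "j < m" "x j \<noteq> 0" using hvec_nonzero u unfolding x_def by blast
    then show ?thesis by (intro exI[of _ "Suc j"]) (simp add: y_def)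
  qed
  have srow: "srow y j = s j *v v - hrow x j" for j
    unfolding srow_split by (simp add: y_def hankel_row_minus)
  have srow0: "srow y 0 = - (z *s v)"
    using root unfolding srow by (simp add: even_poly_def v_def x_def eq_neg_iff_add_eq_0)
  have srow_Suc: "srow y (Suc j) = z\<^sup>2 *s hrow x j" for j
    unfolding srow using row_hvec[of "z\<^sup>2" u j] by (simp add: x_def v_def algebra_simps)
  define a where "a = Re (hankel_form (\<lambda>k. s (Suc k)) m x)"
  define c where "c = Re (hankel_form s (Suc m) y)"
  define b where "b = Re (cinner v v)"
  have a: "hankel_form (\<lambda>k. s (Suc k)) m x = of_real a"
    using Im_hankel_form[of m "\<lambda>k. s (Suc k)" x] herm by (simp add: a_def complex_eq_iff)
  have a0: "a \<ge> 0"
  proof (cases "\<exists>j<m. x j \<noteq> 0")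
    case True
    then show ?thesis using pos(2) by (force simp: a_def hankel_pos_def)
  next
    case False
    then show ?thesis by (simp add: a_def hankel_form_def cinner_zero_left)
  qed
  have c: "hankel_form s (Suc m) y = of_real c" "c > 0"
    using Im_hankel_form[of "Suc m" s y] herm pos(1) y0
    by (auto simp: c_def hankel_pos_def complex_eq_iff)
  have b: "cinner v v = of_real b" "b \<ge> 0"
    by (auto simp: b_def complex_eq_iff Im_cinner_self Re_cinner_self_nonneg)
  have "hankel_form s (Suc m) y = cinner v (srow y 0) - (\<Sum>j<m. cinner (x j) (srow y (Suc j)))"
    unfolding hankel_form_def
    by (subst sum.lessThan_Suc_shift) (simp add: y_def cinner_minus_left sum_negf)
  also have "\<dots> = - z * b - z\<^sup>2 * a"
    unfolding srow0 srow_Suc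
    by (simp add: cinner_minus_right cinner_scale_right b hankel_form_def flip: a sum_distrib_left)
  finally have quad: "of_real a * z\<^sup>2 + of_real b * z + of_real c = 0"
    unfolding c by (simp add: algebra_simps eq_neg_iff_add_eq_0)
  \<comment> \<open>If v = 0, row 0 of the smaller matrix applied to x vanishes, and the row
    relations carry this to all rows; then the larger matrix kills y, against c > 0.\<close>
  have "b \<noteq> 0"
  proof
    assume "b = 0"
    then have v: "v = 0" using b by (simp add: cinner_self_eq_0)
    then have s0: "srow y 0 = 0" using srow0 by simp
    then have h0: "hrow x 0 = 0" using srow[of 0] v by simp
    have "hrow x (Suc j) = 0" if "hrow x j = 0" for j
      using srow_Suc[of j] srow[of "Suc j"] that v by simp
    then have h: "hrow x j = 0" for j by (induction j) (use h0 in auto)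
    have "srow y j = 0" for j using srow[of j] h v by simp
    then show False using c by (simp add: hankel_form_def cinner_zero_right)
  qed
  then show ?thesis using quadratic_root_left_half_plane[OF quad] a0 b c by simp
qed

lemma hankel_pos_odd:
  assumes hurw: "\<And>z u. u \<noteq> 0 \<Longrightarrow> even_poly (z\<^sup>2) u + z *s poly_B (z\<^sup>2) u = 0 \<Longrightarrow> Re z < 0"
  shows "hankel_pos s (Suc m)" and "hankel_pos (\<lambda>k. s (Suc k)) m"
proof -
  \<comment> \<open>The eigenvalue equation is (1/z) P (y, \<xi>) = G (y, \<xi>); it forces \<xi> = z x and
    y = (v, -x) with x the Horner vector of a kernel vector of F(z).\<close>
  define I :: "(nat + nat) set" where "I = {..<Suc m} <+> {..<m}"
  define P where "P v = case_sum (\<lambda>j. if j < Suc m then srow (\<lambda>i. v (Inl i)) j else 0)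
      (\<lambda>j. if j < m then hrow (\<lambda>i. v (Inr i)) j else 0)" for v :: "nat + nat \<Rightarrow> complex^'p"
  \<comment> \<open>For a root, the rows of y = (v, -x) and \<xi> = z x are \<open>srow y 0\<close>
    = -z v and \<open>srow y (Suc j)\<close> = z times \<open>hrow\<close> of \<xi>; dividing by z
    is what makes 1/z the pencil value. The \<open>hrow\<close> couplings are skew, so block
    \<open>Inl 0\<close> alone contributes to the real part, namely -|v|^2.\<close>
  define G where "G v = case_sum
      (\<lambda>j. case j of 0 \<Rightarrow> - v (Inl 0) | Suc i \<Rightarrow> if i < m then hrow (\<lambda>i. v (Inr i)) i else 0)
      (\<lambda>j. if j < m then - hrow (\<lambda>i. v (Inl (Suc i))) j else 0)"
    for v :: "nat + nat \<Rightarrow> complex^'p"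
  have inj: "x = 0" if "x \<in> block_space {..<m}" "\<And>j. j < m \<Longrightarrow> hrow x j = 0" for x
  proof (rule hankel_inj_of_no_root[OF _ _ that])
    show "Re z < 0" if "u \<noteq> 0" "poly_B (z\<^sup>2) u = 0" "hrow (hvec (z\<^sup>2) u) 0 = 0" for z u
      using hurw[OF that(1)] that by (simp add: even_poly_def)
  qed (use herm in auto)
  have adj1: "(\<Sum>j<m. cinner (x j) (hrow y j)) = (\<Sum>j<m. cinner (hrow x j) (y j))" for x y
    using hankel_row_adjoint[of m "\<lambda>k. s (Suc k)" x y] herm by simp
  have adj0: "(\<Sum>j<Suc m. cinner (x j) (srow y j)) = (\<Sum>j<Suc m. cinner (srow x j) (y j))" for x y
    using hankel_row_adjoint[of "Suc m" s x y] herm by simp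
  have inr: "(\<lambda>i. v (Inr i)) \<in> block_space {..<m}"
    and tail: "(\<lambda>i. v (Inl (Suc i))) \<in> block_space {..<m}"
    if "v \<in> block_space I" for v :: "nat + nat \<Rightarrow> complex^'p"
  proof -
    have "v (Inl (Suc i)) = 0" if "\<not> i < m" for i
      using \<open>v \<in> block_space I\<close> that unfolding block_space_def I_def
      by (auto dest!: spec[of _ "Inl (Suc i)"])
    then show "(\<lambda>i. v (Inr i)) \<in> block_space {..<m}" "(\<lambda>i. v (Inl (Suc i))) \<in> block_space {..<m}"
      using that by (auto simp: block_space_def I_def)
  qed
  have sum0: "v = 0" if "v (Inl 0) = 0" "(\<lambda>i. v (Inl (Suc i))) = 0" "(\<lambda>i. v (Inr i)) = 0"
    for v :: "nat + nat \<Rightarrow> complex^'p"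
  proof
    fix i
    have "v (Inl j) = 0" for j using that by (cases j) (auto simp: fun_eq_iff)
    then show "v i = 0 i" using that by (cases i) (auto simp: fun_eq_iff)
  qed
  \<comment> \<open>This reverses the row relations behind \<open>root_left_half_plane_odd\<close>.
    It is stated for all z because it serves twice: at z = 0 for injectivity of P, and at z = 1 /
    \<kappa> for stability.\<close>
  have lift: "\<exists>u. (\<lambda>i. - y (Suc i)) = hvec (z\<^sup>2) u \<and> poly_B (z\<^sup>2) u = y 0 \<and>
      even_poly (z\<^sup>2) u + z *s poly_B (z\<^sup>2) u = 0"
    if y: "(\<lambda>i. y (Suc i)) \<in> block_space {..<m}" and y0: "srow y 0 = - (z *s y 0)"
      and y_Suc: "\<And>j. j < m \<Longrightarrow> srow y (Suc j) = z\<^sup>2 *s hrow (\<lambda>i. - y (Suc i)) j" for y z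
  proof -
    define x where "x = (\<lambda>i. - y (Suc i))"
    have xin: "x \<in> block_space {..<m}" using y by (simp add: x_def block_space_def)
    have srow: "srow y j = s j *v y 0 - hrow x j" for j
      unfolding srow_split x_def by (simp add: hankel_row_minus)
    have "z\<^sup>2 *s hrow x j + hrow x (Suc j) = s (Suc j) *v y 0" if "j < m" for j
      using y_Suc[OF that] unfolding srow x_def[symmetric] by (simp add: algebra_simps)
    then obtain u where u: "x = hvec (z\<^sup>2) u" "poly_B (z\<^sup>2) u = y 0"
      using resolvent_lift[OF inj xin, of "z\<^sup>2" "y 0"] by blast
    moreover have "even_poly (z\<^sup>2) u + z *s poly_B (z\<^sup>2) u = 0"
      using y0 unfolding srow by (simp add: even_poly_def u flip: u(1))
    ultimately show ?thesis unfolding x_def by blast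
  qed
  interpret block_pencil I P G
  proof
    fix v :: "nat + nat \<Rightarrow> complex^'p" assume v: "v \<in> block_space I" "P v = 0"
    let ?y = "\<lambda>i. v (Inl i)"
    have P0: "srow ?y j = 0" if "j < Suc m" for j
      using fun_cong[OF v(2), of "Inl j"] that by (simp add: P_def)
    have "hrow (\<lambda>i. v (Inr i)) j = 0" if "j < m" for j
      using fun_cong[OF v(2), of "Inr j"] that by (simp add: P_def)
    with inr[OF v(1)] have r0: "(\<lambda>i. v (Inr i)) = 0" by (rule inj)
    obtain u where u: "(\<lambda>i. - ?y (Suc i)) = hvec 0 u" "poly_B 0 u = ?y 0"
        "even_poly 0 u = 0"
      using lift[of ?y 0] tail[OF v(1)] P0 by auto
    have "u = 0" using hurw[of u 0] u by auto
    then have "?y 0 = 0" "(\<lambda>i. - ?y (Suc i)) = 0" using u hvec_zero by (auto simp: mvpoly_def)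
    then show "v = 0" using r0 by (intro sum0) (auto simp: fun_eq_iff)
  next
    fix u v :: "nat + nat \<Rightarrow> complex^'p"
    show "block_inner I u (P v) = block_inner I (P u) v"
      unfolding I_def by (simp add: block_inner_Plus P_def adj0 adj1 del: sum.lessThan_Suc)
  next
    fix v :: "nat + nat \<Rightarrow> complex^'p"
    let ?x = "\<lambda>i. v (Inl (Suc i))" and ?y = "\<lambda>i. v (Inr i)"
    have "(\<Sum>j<Suc m. cinner (v (Inl j)) (G v (Inl j))) =
        - cinner (v (Inl 0)) (v (Inl 0)) + (\<Sum>j<m. cinner (?x j) (hrow ?y j))"
      by (subst sum.lessThan_Suc_shift) (simp add: G_def cinner_minus_right)
    then have "block_inner I v (G v) = - cinner (v (Inl 0)) (v (Inl 0))
        + (\<Sum>j<m. cinner (?x j) (hrow ?y j)) - (\<Sum>j<m. cinner (?y j) (hrow ?x j))"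
      unfolding I_def by (simp add: block_inner_Plus G_def cinner_minus_right sum_negf del: sum.lessThan_Suc)
    moreover have "cnj (\<Sum>j<m. cinner (?x j) (hrow ?y j)) = (\<Sum>j<m. cinner (?y j) (hrow ?x j))"
      by (simp add: cnj_cinner adj1)
    from Re_eq_of_cnj_eq[OF this]
    have "Re (\<Sum>j<m. cinner (?x j) (hrow ?y j)) = Re (\<Sum>j<m. cinner (?y j) (hrow ?x j))" .
    ultimately show "Re (block_inner I v (G v)) \<le> 0"
      using Re_cinner_self_nonneg[of "v (Inl 0)"] by simp
  next
    fix v :: "nat + nat \<Rightarrow> complex^'p" and \<kappa>
    let ?y = "\<lambda>i. v (Inl i)" and ?x = "\<lambda>i. v (Inl (Suc i))" and ?\<xi> = "\<lambda>i. v (Inr i)"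
    assume v: "v \<in> block_space I" "v \<noteq> 0" and eq: "block_scale \<kappa> (P v) = G v"
    have eq0: "\<kappa> *s srow ?y 0 = - ?y 0"
      using fun_cong[OF eq, of "Inl 0"] by (simp add: block_scale_def P_def G_def)
    have eq1: "\<kappa> *s srow ?y (Suc j) = hrow ?\<xi> j"
      and eq2: "\<kappa> *s hrow ?\<xi> j = - hrow ?x j" if "j < m" for j
      using fun_cong[OF eq, of "Inl (Suc j)"] fun_cong[OF eq, of "Inr j"] that
      by (simp_all add: block_scale_def P_def G_def)
    \<comment> \<open>G is injective: its kernel equations annihilate the first block and put the
      remaining two parts into the kernel of the smaller Hankel matrix.\<close>
    have "\<kappa> \<noteq> 0"
    proof
      assume "\<kappa> = 0"
      then have "?y 0 = 0" "\<And>j. j < m \<Longrightarrow> hrow ?\<xi> j = 0" "\<And>j. j < m \<Longrightarrow> hrow ?x j = 0"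
        using eq0 eq1 eq2 by auto
      then have "v = 0" by (intro sum0 inj tail inr v) auto
      then show False using v by simp
    qed
    define z where "z = 1 / \<kappa>"
    have "(\<lambda>i. \<kappa> *s ?\<xi> i + ?x i) = 0"
    proof (rule inj)
      show "(\<lambda>i. \<kappa> *s ?\<xi> i + ?x i) \<in> block_space {..<m}"
        using tail[OF v(1)] inr[OF v(1)] by (simp add: block_space_def)
      show "hrow (\<lambda>i. \<kappa> *s ?\<xi> i + ?x i) j = 0" if "j < m" for j
        using eq2[OF that] by (simp add: hankel_row_add hankel_row_scale)
    qed
    then have x: "\<kappa> *s ?\<xi> i = - ?x i" for i by (simp add: fun_eq_iff eq_neg_iff_add_eq_0)
    have \<xi>: "?\<xi> = (\<lambda>i. z *s (- ?x i))"
      unfolding x[symmetric] using \<open>\<kappa> \<noteq> 0\<close> by (simp add: z_def vector_smult_assoc)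
    have "srow ?y 0 = z *s (\<kappa> *s srow ?y 0)"
      using \<open>\<kappa> \<noteq> 0\<close> by (simp add: z_def vector_smult_assoc)
    then have y0: "srow ?y 0 = - (z *s ?y 0)" unfolding eq0 by simp
    have y_Suc: "srow ?y (Suc j) = z\<^sup>2 *s hrow (\<lambda>i. - ?x i) j" if "j < m" for j
    proof -
      have "srow ?y (Suc j) = z *s (\<kappa> *s srow ?y (Suc j))"
        using \<open>\<kappa> \<noteq> 0\<close> by (simp add: z_def vector_smult_assoc)
      also have "\<dots> = z *s (z *s hrow (\<lambda>i. - ?x i) j)"
        unfolding eq1[OF that] by (subst \<xi>) (simp only: hankel_row_scale)
      finally show ?thesis by (simp add: vector_smult_assoc power2_eq_square)
    qed
    obtain u where u: "(\<lambda>i. - ?x i) = hvec (z\<^sup>2) u" "poly_B (z\<^sup>2) u = ?y 0"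
        "even_poly (z\<^sup>2) u + z *s poly_B (z\<^sup>2) u = 0"
      using lift[of ?y z, OF tail[OF v(1)] y0 y_Suc] by blast
    have "u \<noteq> 0"
    proof
      assume u0: "u = 0"
      then have "?y 0 = 0" using u(2) by (simp add: mvpoly_def)
      moreover have "?x i = 0" for i using fun_cong[OF u(1), of i] u0 hvec_zero by simp
      moreover have "?\<xi> = 0" by (subst \<xi>) (simp add: calculation(2) fun_eq_iff)
      ultimately have "v = 0" by (intro sum0) (auto simp: fun_eq_iff)
      then show False using v by simp
    qed
    then have "Re z < 0" using hurw u(3) by blast
    then show "Re \<kappa> < 0"
      using sum_power2_ge_zero[of "Re \<kappa>" "Im \<kappa>"]
      by (auto simp: z_def Re_divide divide_less_0_iff)
  qed (auto simp: I_def P_def G_def block_space_def fun_eq_iff hankel_row_add hankel_row_scale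
      block_scale_def vector_add_ldistrib vector_smult_rneg split: sum.split nat.split)
  show "hankel_pos s (Suc m)" unfolding hankel_pos_def
  proof (intro allI impI)
    fix x :: "nat \<Rightarrow> complex^'p" assume x: "\<exists>j<Suc m. x j \<noteq> 0"
    define v where "v = case_sum (\<lambda>j. if j < Suc m then x j else 0) (\<lambda>j::nat. 0)"
    have "v \<in> block_space I" by (auto simp: v_def block_space_def I_def split: sum.split)
    moreover have "v \<noteq> 0" using x by (auto simp: v_def fun_eq_iff split: sum.split)
    ultimately have "energy v > 0" by (rule energy_pos)
    moreover have "block_inner I v (P v) = hankel_form s (Suc m) x"
      by (simp add: I_def block_inner_Plus v_def P_def hankel_form_def cinner_zero_left hankel_row_def
          del: sum.lessThan_Suc)
    ultimately show "Re (hankel_form s (Suc m) x) > 0" by simp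
  qed
  show "hankel_pos (\<lambda>k. s (Suc k)) m" unfolding hankel_pos_def
  proof (intro allI impI)
    fix x :: "nat \<Rightarrow> complex^'p" assume x: "\<exists>j<m. x j \<noteq> 0"
    define v where "v = case_sum (\<lambda>j::nat. 0) (\<lambda>j. if j < m then x j else 0)"
    have "v \<in> block_space I" by (auto simp: v_def block_space_def I_def split: sum.split)
    moreover have "v \<noteq> 0" using x by (auto simp: v_def fun_eq_iff split: sum.split)
    ultimately have "energy v > 0" by (rule energy_pos)
    moreover have "block_inner I v (P v) = hankel_form (\<lambda>k. s (Suc k)) m x"
      by (simp add: I_def block_inner_Plus v_def P_def hankel_form_def cinner_zero_left hankel_row_def
          del: sum.lessThan_Suc)
    ultimately show "Re (hankel_form (\<lambda>k. s (Suc k)) m x) > 0" by simp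
  qed
qed

end

section \<open>The equivalence\<close>

lemma block_hankel_pd_iff:
  assumes "\<And>k. k < 2 * q - 1 \<Longrightarrow> hermitian_mat (s (k + d))"
  shows "block_hankel_pd s d q \<longleftrightarrow> hankel_pos (\<lambda>k. s (k + d)) q"
proof -
  have form: "(\<Sum>j<q. \<Sum>k<q. \<Sum>a\<in>UNIV. cnj (x j $ a) * ((s (j + k + d) *v x k) $ a)) =
      hankel_form (\<lambda>k. s (k + d)) q x" for x
    unfolding hankel_form_def hankel_row_def cinner_sum_right unfolding cinner_def ..
  have "s (j + k + d) $ a $ b = cnj (s (k + j + d) $ b $ a)" if "j < q" "k < q" for j k a b
  proof -
    have "hermitian_mat (s (j + k + d))" using assms[of "j + k"] that by simp
    then show ?thesis unfolding hermitian_mat_def add.commute[of k j] by blast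
  qed
  moreover have "Im (hankel_form (\<lambda>k. s (k + d)) q x) = 0" for x
    by (rule Im_hankel_form) (rule assms)
  ultimately show ?thesis
    unfolding block_hankel_pd_def hankel_pos_def form Let_def by blast
qed

lemma stieltjes_pd_iff:
  assumes "\<forall>k<n. hermitian_mat (s k)"
  shows "stieltjes_pd s n \<longleftrightarrow>
    hankel_pos s ((n + 1) div 2) \<and> hankel_pos (\<lambda>k. s (Suc k)) (n div 2)"
proof -
  have "block_hankel_pd s 0 ((n + 1) div 2) \<longleftrightarrow> hankel_pos s ((n + 1) div 2)"
    using block_hankel_pd_iff[of "(n + 1) div 2" s 0] assms by simp
  moreover have "block_hankel_pd s 1 (n div 2) \<longleftrightarrow> hankel_pos (\<lambda>k. s (Suc k)) (n div 2)"
    using block_hankel_pd_iff[of "n div 2" s 1] assms by simp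
  ultimately show ?thesis by (simp add: stieltjes_pd_def)
qed

section \<open>Kernel vectors in place of determinants, and the splitting of F by parity\<close>

lemma det_eq_0_iff_kernel: "det M = 0 \<longleftrightarrow> (\<exists>u. u \<noteq> 0 \<and> M *v u = 0)" for M :: "complex^'p^'p"
  using invertible_det_nz[of M] invertible_left_inverse[of M] matrix_left_invertible_ker[of M] by blast

lemma sum_atMost_reflect: "(\<Sum>k\<in>{0..m}. f (m - k) k) = (\<Sum>i\<le>m. f i (m - i))" for m :: nat
  by (rule sum.reindex_bij_witness[of _ "\<lambda>i. m - i" "\<lambda>i. m - i"]) auto

lemma hurwitz_mpoly_iff:
  "hurwitz_mpoly A n \<longleftrightarrow> (\<forall>z u. u \<noteq> 0 \<longrightarrow> mvpoly (\<lambda>i. A (n - i)) n z u = 0 \<longrightarrow> Re z < 0)"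
proof -
  have "mpoly_eval A n z *v u = mvpoly (\<lambda>i. A (n - i)) n z u" for z u
    unfolding mvpoly_eq mpoly_eval_def
    using sum_atMost_reflect[of "\<lambda>i k. cmat_scale (z ^ i) (A k)" n] by simp
  then show ?thesis by (auto simp: hurwitz_mpoly_def det_eq_0_iff_kernel)
qed

text \<open>The odd part has degree below m; padding it with a zero coefficient gives both parts the
  common bound m that \<open>markov_series_coeffs\<close> uses.\<close>

lemma mvpoly_split_even:
  "mvpoly D (2 * m) z u = mvpoly (\<lambda>i. D (2 * i)) m (z\<^sup>2) u
     + z *s mvpoly (\<lambda>i. if i < m then D (2 * i + 1) else 0) m (z\<^sup>2) u"
proof -
  have "(\<Sum>i\<le>2 * m. f i) = (\<Sum>i\<le>m. f (2 * i)) + (\<Sum>i<m. f (2 * i + 1))" for f :: "nat \<Rightarrow> complex^'p"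
    by (induction m) (simp_all add: algebra_simps)
  from this[of "\<lambda>i. z ^ i *s (D i *v u)"] show ?thesis
    by (simp add: mvpoly_def power_mult vector_scale_sum vector_smult_assoc flip: lessThan_Suc_atMost)
qed

lemma mvpoly_split_odd:
  "mvpoly D (2 * m + 1) z u = mvpoly (\<lambda>i. D (2 * i)) m (z\<^sup>2) u
     + z *s mvpoly (\<lambda>i. D (2 * i + 1)) m (z\<^sup>2) u"
proof -
  have "(\<Sum>i\<le>2 * m + 1. f i) = (\<Sum>i\<le>m. f (2 * i)) + (\<Sum>i\<le>m. f (2 * i + 1))" for f :: "nat \<Rightarrow> complex^'p"
    by (induction m) (simp_all add: algebra_simps)
  from this[of "\<lambda>i. z ^ i *s (D i *v u)"] show ?thesis
    by (simp add: mvpoly_def power_mult vector_scale_sum vector_smult_assoc)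
qed

lemma hurwitz_iff_stieltjes_even:
  assumes "monic_mpoly A" and markov: "markov_params A (2 * m) s"
    and herm: "\<forall>k<2 * m. hermitian_mat (s k)"
  shows "hurwitz_mpoly A (2 * m) \<longleftrightarrow> stieltjes_pd s (2 * m)"
proof -
  define B where "B i = A (2 * m - 2 * i)" for i
  \<comment> \<open>The case i = m must be set to 0 explicitly: truncated subtraction would
    otherwise return A_0, the identity.\<close>
  define C where "C i = (if i < m then A (2 * m - (2 * i + 1)) else 0)" for i
  have even: "even_part A (2 * m) w = (\<Sum>i\<le>m. cmat_scale (w ^ i) (B i))" for w
    using sum_atMost_reflect[of "\<lambda>i k. cmat_scale (w ^ i) (A (2 * k))" m]
    by (simp add: even_part_def B_def diff_mult_distrib2)
  have odd: "odd_part A (2 * m) w = (\<Sum>i\<le>m. cmat_scale (w ^ i) (C i))" for w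
  proof -
    have "odd_part A (2 * m) w = (\<Sum>i<m. cmat_scale (w ^ i) (C i))"
      unfolding odd_part_def
      by (simp, rule sum.reindex_bij_witness[of _ "\<lambda>i. m - i" "\<lambda>i. m - i"])
        (auto simp: C_def diff_mult_distrib2)
    also have "\<dots> = (\<Sum>i\<le>m. cmat_scale (w ^ i) (C i))"
      by (simp add: C_def cmat_scale_def flip: lessThan_Suc_atMost) (simp add: vec_eq_iff)
    finally show ?thesis .
  qed
  from markov obtain R where "\<And>w. R < norm w \<Longrightarrow> invertible (\<Sum>i\<le>m. cmat_scale (w ^ i) (B i)) \<and>
      (\<lambda>k. cmat_scale ((-1) ^ k / w ^ (k + 1)) (s k)) sums
        ((\<Sum>i\<le>m. cmat_scale (w ^ i) (C i)) ** matrix_inv (\<Sum>i\<le>m. cmat_scale (w ^ i) (B i)))"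
    unfolding markov_params_def even odd by auto
  note coeffs = markov_series_coeffs[OF this]
  interpret monic_hankel m B s
  proof
    show "B m = mat 1" using assms(1) by (simp add: B_def monic_mpoly_def)
  qed (rule coeffs(1))
  \<comment> \<open>The first Hankel row on a Horner vector is F_o(z^2) u, so F(z) u takes the form
    treated by the two directions.\<close>
  have F: "mvpoly (\<lambda>i. A (2 * m - i)) (2 * m) z u = poly_B (z\<^sup>2) u + z *s hrow (hvec (z\<^sup>2) u) 0" for z u
    unfolding mvpoly_split_even using coeffs(2)[where w = "z\<^sup>2" and u = u]
    by (simp add: B_def[abs_def] C_def[abs_def])
  have div: "(2 * m + 1) div 2 = m" "2 * m div 2 = m" by simp_all
  have herm': "hermitian_mat (s k)" if "k < 2 * m" for k using herm that by simp
  show ?thesis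
    unfolding hurwitz_mpoly_iff stieltjes_pd_iff[OF herm] F div
    using root_left_half_plane_even[OF herm'] hankel_pos_even[OF herm'] by blast
qed

lemma matrix_diff_mult: "(A - B) ** C = A ** C - B ** C" for A :: "complex^'n^'m"
  by (simp add: matrix_matrix_mult_def vec_eq_iff left_diff_distrib sum_subtractf)

lemma hurwitz_iff_stieltjes_odd:
  assumes "monic_mpoly A" and markov: "markov_params A (2 * m + 1) s"
    and hermitian: "\<forall>k<2 * m + 1. hermitian_mat (s k)"
  shows "hurwitz_mpoly A (2 * m + 1) \<longleftrightarrow> stieltjes_pd s (2 * m + 1)"
proof -
  define E where "E i = A (2 * m + 1 - 2 * i)" for i
  define B where "B i = A (2 * m + 1 - (2 * i + 1))" for i
  \<comment> \<open>The numerator of s_0 - F_e F_o^-1 over F_o; subtracting from s_0 also turns the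
    signs of the remaining series into (-1)^k.\<close>
  define C where "C i = s 0 ** B i - E i" for i
  define FB where "FB w = (\<Sum>i\<le>m. cmat_scale (w ^ i) (B i))" for w
  define FE where "FE w = (\<Sum>i\<le>m. cmat_scale (w ^ i) (E i))" for w
  have even: "even_part A (2 * m + 1) w = FE w" for w
    using sum_atMost_reflect[of "\<lambda>i k. cmat_scale (w ^ i) (A (2 * k + 1))" m]
    by (simp add: even_part_def FE_def E_def diff_mult_distrib2 Suc_diff_le)
  have odd: "odd_part A (2 * m + 1) w = FB w" for w
    using sum_atMost_reflect[of "\<lambda>i k. cmat_scale (w ^ i) (A (2 * k))" m]
    by (simp add: odd_part_def FB_def B_def diff_mult_distrib2)
  have C: "mvpoly C m w u = s 0 *v mvpoly B m w u - mvpoly E m w u" for w u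
    by (simp add: mvpoly_def C_def matrix_vector_mult_diff_rdistrib vector_ssub_ldistrib sum_subtractf
        matrix_vector_mult_sum vector_scalar_commute matrix_vector_mul_assoc)
  then have FC: "(\<Sum>i\<le>m. cmat_scale (w ^ i) (C i)) = s 0 ** FB w - FE w" for w
    by (simp add: matrix_eq mvpoly_eq FB_def FE_def matrix_vector_mult_diff_rdistrib
        flip: matrix_vector_mul_assoc)
  from markov obtain R where R: "\<And>w. R < norm w \<Longrightarrow> invertible (FB w) \<and>
      (\<lambda>k. cmat_scale ((-1) ^ k / w ^ k) (s k)) sums (FE w ** matrix_inv (FB w))"
    unfolding markov_params_def even odd by auto
  have "invertible (\<Sum>i\<le>m. cmat_scale (w ^ i) (B i)) \<and>
      (\<lambda>k. cmat_scale ((-1) ^ k / w ^ (k + 1)) (s (Suc k))) sums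
        ((\<Sum>i\<le>m. cmat_scale (w ^ i) (C i)) ** matrix_inv (\<Sum>i\<le>m. cmat_scale (w ^ i) (B i)))"
    if w: "R < norm w" for w
  proof -
    have inv: "invertible (FB w)" using R[OF w] by simp
    then have "FB w ** matrix_inv (FB w) = mat 1"
      unfolding invertible_def matrix_inv_def by (rule someI2_ex) blast
    then have eq: "(s 0 ** FB w - FE w) ** matrix_inv (FB w) = s 0 - FE w ** matrix_inv (FB w)"
      by (simp add: matrix_diff_mult flip: matrix_mul_assoc)
    have "(\<lambda>k. cmat_scale ((-1) ^ Suc k / w ^ Suc k) (s (Suc k))) sums
        (FE w ** matrix_inv (FB w) - cmat_scale ((-1) ^ 0 / w ^ 0) (s 0))"
      using R[OF w] by (subst sums_Suc_iff) simp
    from sums_minus[OF this] have S: "(\<lambda>k. - cmat_scale ((-1) ^ Suc k / w ^ Suc k) (s (Suc k))) sums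
        (s 0 - FE w ** matrix_inv (FB w))"
      by (simp add: cmat_scale_def)
    have N: "- cmat_scale ((-1) ^ Suc k / w ^ Suc k) M = cmat_scale ((-1) ^ k / w ^ (k + 1)) M"
      for k and M :: "complex^'p^'p"
      by (simp add: cmat_scale_def vec_eq_iff)
    show ?thesis using inv S unfolding FC eq FB_def[symmetric] N by blast
  qed
  note coeffs = markov_series_coeffs[OF this]
  interpret monic_hankel_shifted m B s
  proof
    show "B m = mat 1" using assms(1) by (simp add: B_def monic_mpoly_def)
    show "hermitian_mat (s k)" if "k \<le> 2 * m" for k using hermitian that by simp
  qed (rule coeffs(1))
  have even_poly: "mvpoly E m w u = even_poly w u" for w u
    using coeffs(2)[where w = w and u = u] by (simp add: C even_poly_def algebra_simps)
  have F: "mvpoly (\<lambda>i. A (2 * m + 1 - i)) (2 * m + 1) z u = even_poly (z\<^sup>2) u + z *s poly_B (z\<^sup>2) u" for z u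
    unfolding mvpoly_split_odd even_poly[symmetric] by (simp add: B_def[abs_def] E_def[abs_def])
  have div: "(2 * m + 1 + 1) div 2 = Suc m" "(2 * m + 1) div 2 = m" by simp_all
  show ?thesis
    unfolding hurwitz_mpoly_iff stieltjes_pd_iff[OF hermitian] F div
    using root_left_half_plane_odd hankel_pos_odd by blast
qed

theorem theorem4p4:
  fixes A s :: "nat \<Rightarrow> complex^'p^'p" and n :: nat
  assumes "monic_mpoly A"
    and "markov_params A n s"
    and "\<forall>k<n. hermitian_mat (s k)"
  shows "hurwitz_mpoly A n \<longleftrightarrow> stieltjes_pd s n"
proof (cases "even n")
  case True
  then obtain m where "n = 2 * m" by blast
  then show ?thesis using hurwitz_iff_stieltjes_even assms by blast
next
  case False
  then obtain m where "n = 2 * m + 1" by (rule oddE)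
  then show ?thesis using hurwitz_iff_stieltjes_odd assms by blast
qed

end
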